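(* Let $n$ be a positive integer, let $A=(A_{ij})$ be an $n\times n$ matrix and let $\theta=(\theta_1,\ldots,\theta_n)$, $\phi=(\phi_1,\ldots,\phi_n)$ be row vectors. Then $$\sum_{\mathbf r\in\mathbb{Z}_{\ge0}^n}\frac{1}{\mathbf r!}\,\mathrm{pperm}_{\beta\theta\phi}\,A(n^{\mathbf r},n^{\mathbf r})=\frac{e^{\theta(I-A)^{-1}\phi^{T}}}{\det(I-A)^{\beta}},$$ where $\phi^T$ denotes the transpose of the row vector $\phi$.
   Context: Partial permutations: a partial permutation $\psi$ of a finite set $X$ is an injective partial map from $X$ to itself, with domain $\mathrm{dom}\,\psi\subseteq X$ and image $\mathrm{im}\,\psi\subseteq X$ (the empty map is allowed). Let $C(\pi_\psi)$ denote the number of cycles of $\psi$, i.e. the number of cycles of the (possibly empty) permutation $\pi_\psi$ obtained by restricting $\psi$ to the largest subset of $X$ that $\psi$ maps bijectively onto itself (fixed points count as cycles of length 1). Extended partial permanent: for a square matrix $M=(M_{xy})$ indexed by a finite set $X$ and vectors $\theta=(\theta_x)_{x\in X}$, $\phi=(\phi_x)_{x\in X}$, $$\mathrm{pperm}_{\beta\theta\phi}M=\sum_{\psi}\beta^{C(\pi_\psi)}\prod_{x\in\mathrm{dom}\,\psi}M_{x\psi(x)}\prod_{y\notin\mathrm{im}\,\psi}\theta_y\prod_{z\notin\mathrm{dom}\,\psi}\phi_z,$$ the sum being over all partial permutations $\psi$ of $X$. For $X=\emptyset$ the value is $1$. Multisets: for $\mathbf r=(r_1,\ldots,r_n)\in\mathbb{Z}_{\ge0}^n$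 put $\mathbf r!=r_1!\cdots r_n!$, $N=r_1+\cdots+r_n$, and let $n^{\mathbf r}=\{1_1,\ldots,1_{r_1},\ldots,n_1,\ldots,n_{r_n}\}$ be the multiset of size $N$ in which the index $i$ is repeated $r_i$ times; the labelled copies $i_a$ ($1\le a\le r_i$) are treated as $N$ distinct indices. $A(n^{\mathbf r},n^{\mathbf r})$ is the $N\times N$ matrix indexed by $n^{\mathbf r}$ with $(i_a,j_b)$ entry $A_{ij}$, and $\mathrm{pperm}_{\beta\theta\phi}A(n^{\mathbf r},n^{\mathbf r})$ is formed with the $N$-vectors whose $i_a$ components are $\theta_{i_a}=\theta_i$ and $\phi_{i_a}=\phi_i$. Interpretation: $\beta$, the entries of $A$, and the components of $\theta,\phi$ are commuting indeterminates and the identity is one of formal power series with rational coefficients in them; $(I-A)^{-1}=\sum_{k\ge0}A^k$ and $\det(I-A)^{-\beta}$ means $\exp\left(\beta\sum_{t\ge1}\frac1t\mathrm{Tr}(A^t)\right)$. $I$ is the identity matrix. *)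

theory Defs
  imports "HOL-Analysis.Analysis" "HOL-Combinatorics.Orbits" "HOL-Library.Poly_Mapping"
begin

section \<open>Formal power series in arbitrarily many commuting indeterminates\<close>

text \<open>
  A monomial in the indeterminates \<^typ>\<open>'v\<close> is a finitely supported exponent function, and a
  power series is an arbitrary function from monomials to coefficients.
\<close>

typedef (overloaded) ('v, 'a) mps = "UNIV :: (('v \<Rightarrow>\<^sub>0 nat) \<Rightarrow> 'a) set"
  morphisms mps_coeff Abs_mps ..

setup_lifting type_definition_mps

lemma mps_eqI: "(\<And>m. mps_coeff f m = mps_coeff g m) \<Longrightarrow> f = g"
  by transfer auto

lemma mps_coeff_Abs [simp]: "mps_coeff (Abs_mps c) = c"
  by (simp add: Abs_mps_inverse)

definition splits :: "('v \<Rightarrow>\<^sub>0 nat) \<Rightarrow> (('v \<Rightarrow>\<^sub>0 nat) \<times> ('v \<Rightarrow>\<^sub>0 nat)) set" where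
  "splits m = {(a, b). a + b = m}"

lemma finite_splits [simp]: "finite (splits m)"
proof -
  let ?K = "Poly_Mapping.keys m"
  let ?B = "Max (Poly_Mapping.lookup m ` ?K)"
  let ?D = "{a. \<exists>b. a + b = m}"
  have "Poly_Mapping.lookup ` ?D \<subseteq> {f. \<forall>x. (x \<in> ?K \<longrightarrow> f x \<in> {..?B}) \<and> (x \<notin> ?K \<longrightarrow> f x = 0)}"
  proof (intro image_subsetI CollectI allI conjI impI)
    fix a x
    assume "a \<in> ?D"
    then have le: "Poly_Mapping.lookup a x \<le> Poly_Mapping.lookup m x"
      by (auto simp: lookup_add)
    show "Poly_Mapping.lookup a x \<in> {..?B}" if "x \<in> ?K"
      unfolding atMost_iff by (rule order_trans[OF le Max_ge]) (use that in simp_all)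
    show "Poly_Mapping.lookup a x = 0" if "x \<notin> ?K"
      using that le by (simp add: in_keys_iff)
  qed
  then have "finite (Poly_Mapping.lookup ` ?D)"
    by (rule finite_subset) (rule finite_set_of_finite_funs, simp_all)
  then have "finite ?D"
    by (rule finite_imageD) (simp add: inj_on_def lookup_inject)
  moreover have "splits m \<subseteq> (\<lambda>a. (a, m - a)) ` ?D"
    by (auto simp: splits_def)
  ultimately show ?thesis
    by (meson finite_imageI finite_subset)
qed

instantiation mps :: (type, comm_ring_1) comm_ring_1
begin

lift_definition zero_mps :: "('a, 'b) mps" is "\<lambda>_. 0" .
lift_definition one_mps :: "('a, 'b) mps" is "\<lambda>m. if m = 0 then 1 else 0" .
lift_definition plus_mps :: "('a, 'b) mps \<Rightarrow> ('a, 'b) mps \<Rightarrow> ('a, 'b) mps"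
  is "\<lambda>f g m. f m + g m" .
lift_definition minus_mps :: "('a, 'b) mps \<Rightarrow> ('a, 'b) mps \<Rightarrow> ('a, 'b) mps"
  is "\<lambda>f g m. f m - g m" .
lift_definition uminus_mps :: "('a, 'b) mps \<Rightarrow> ('a, 'b) mps"
  is "\<lambda>f m. - f m" .
lift_definition times_mps :: "('a, 'b) mps \<Rightarrow> ('a, 'b) mps \<Rightarrow> ('a, 'b) mps"
  is "\<lambda>f g m. \<Sum>(a, b)\<in>splits m. f a * g b" .

instance
proof
  fix f g h :: "('a, 'b) mps"
  show "f * g * h = f * (g * h)"
  proof (transfer, rule ext)
    fix f g h :: "('a \<Rightarrow>\<^sub>0 nat) \<Rightarrow> 'b" and m
    have "(\<Sum>(a, b)\<in>splits m. (\<Sum>(c, d)\<in>splits a. f c * g d) * h b)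
        = (\<Sum>x\<in>splits m. \<Sum>y\<in>splits (fst x). f (fst y) * g (snd y) * h (snd x))"
      by (simp add: sum_distrib_right case_prod_beta)
    also have "\<dots> = (\<Sum>(x, y)\<in>Sigma (splits m) (\<lambda>x. splits (fst x)). f (fst y) * g (snd y) * h (snd x))"
      by (rule sum.Sigma) auto
    also have "\<dots> = (\<Sum>(x, y)\<in>Sigma (splits m) (\<lambda>x. splits (snd x)). f (fst x) * g (fst y) * h (snd y))"
      by (rule sum.reindex_bij_witness[where
            i = "\<lambda>(x, y). ((fst x + fst y, snd y), (fst x, fst y))" and
            j = "\<lambda>(x, y). ((fst y, snd y + snd x), (snd y, snd x))"])
         (auto simp: splits_def add.assoc)
    also have "\<dots> = (\<Sum>x\<in>splits m. \<Sum>y\<in>splits (snd x). f (fst x) * g (fst y) * h (snd y))"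
      by (rule sum.Sigma[symmetric]) auto
    also have "\<dots> = (\<Sum>(a, b)\<in>splits m. f a * (\<Sum>(c, d)\<in>splits b. g c * h d))"
      by (simp add: sum_distrib_left case_prod_beta mult.assoc)
    finally show "(\<Sum>(a, b)\<in>splits m. (\<Sum>(a, b)\<in>splits a. f a * g b) * h b) =
      (\<Sum>(a, b)\<in>splits m. f a * (\<Sum>(a, b)\<in>splits b. g a * h b))" .
  qed
  show "f * g = g * f"
  proof (transfer, rule ext)
    fix f g :: "('a \<Rightarrow>\<^sub>0 nat) \<Rightarrow> 'b" and m
    show "(\<Sum>(a, b)\<in>splits m. f a * g b) = (\<Sum>(a, b)\<in>splits m. g a * f b)"
      by (rule sum.reindex_bij_witness[where i = prod.swap and j = prod.swap])
         (auto simp: splits_def add.commute mult.commute)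
  qed
  show "1 * f = f"
  proof (transfer, rule ext)
    fix f :: "('a \<Rightarrow>\<^sub>0 nat) \<Rightarrow> 'b" and m
    have "(\<Sum>(a, b)\<in>splits m. (if a = 0 then 1 else 0) * f b)
        = (\<Sum>(a, b)\<in>{(0 :: 'a \<Rightarrow>\<^sub>0 nat, m)}. (if a = 0 then 1 else 0) * f b)"
      by (intro sum.mono_neutral_right finite_splits) (auto simp: splits_def split: if_splits)
    then show "(\<Sum>(a, b)\<in>splits m. (if a = 0 then 1 else 0) * f b) = f m"
      by simp
  qed
  show "(f + g) * h = f * h + g * h"
    by transfer (simp add: fun_eq_iff case_prod_beta distrib_right sum.distrib)
  show "(0 :: ('a, 'b) mps) \<noteq> 1"
  proof (transfer, rule notI)
    assume "(\<lambda>_. 0) = (\<lambda>m :: 'a \<Rightarrow>\<^sub>0 nat. if m = 0 then 1 else (0 :: 'b))"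
    from fun_cong[OF this, of 0] show False by simp
  qed
  show "f + g + h = f + (g + h)"
    by transfer (simp add: add.assoc)
  show "f + g = g + f"
    by transfer (simp add: add.commute)
  show "0 + f = f"
    by transfer simp
  show "- f + f = 0"
    by transfer simp
  show "f - g = f + - g"
    by transfer simp
qed

end

lemma mps_coeff_add [simp]: "mps_coeff (f + g) m = mps_coeff f m + mps_coeff g m"
  and mps_coeff_zero [simp]: "mps_coeff 0 m = 0"
  and mps_coeff_one: "mps_coeff 1 m = (if m = 0 then 1 else 0)"
  and mps_coeff_mult: "mps_coeff (f * g) m = (\<Sum>(a, b)\<in>splits m. mps_coeff f a * mps_coeff g b)"
  by (simp_all add: plus_mps.rep_eq zero_mps.rep_eq one_mps.rep_eq times_mps.rep_eq)

lemma mps_coeff_sum [simp]: "mps_coeff (sum F I) m = (\<Sum>i\<in>I. mps_coeff (F i) m)"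
  by (induction I rule: infinite_finite_induct) auto

definition mps_const :: "'a::comm_ring_1 \<Rightarrow> ('v, 'a) mps" where
  "mps_const c = Abs_mps (\<lambda>m. if m = 0 then c else 0)"

definition mps_indet :: "'v \<Rightarrow> ('v, 'a::comm_ring_1) mps" where
  "mps_indet v = Abs_mps (\<lambda>m. if m = Poly_Mapping.single v 1 then 1 else 0)"

text \<open>
  The usual topology of formal power series: coefficientwise convergence, with discrete
  coefficients. All infinite sums below (\<^const>\<open>has_sum\<close>, \<^const>\<open>infsum\<close>) refer to it.
\<close>

instantiation mps :: (type, type) t2_space
begin

definition open_mps :: "('a, 'b) mps set \<Rightarrow> bool" where
  "open_mps S \<longleftrightarrow>
    (\<forall>f\<in>S. \<exists>K. finite K \<and> (\<forall>g. (\<forall>m\<in>K. mps_coeff g m = mps_coeff f m) \<longrightarrow> g \<in> S))"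

instance
proof
  show "open (UNIV :: ('a, 'b) mps set)"
    by (auto simp: open_mps_def)
next
  fix S T :: "('a, 'b) mps set"
  assume S: "open S" and T: "open T"
  show "open (S \<inter> T)"
    unfolding open_mps_def
  proof
    fix f assume f: "f \<in> S \<inter> T"
    obtain K where "finite K" "\<forall>g. (\<forall>m\<in>K. mps_coeff g m = mps_coeff f m) \<longrightarrow> g \<in> S"
      using S f unfolding open_mps_def by blast
    moreover obtain L where "finite L" "\<forall>g. (\<forall>m\<in>L. mps_coeff g m = mps_coeff f m) \<longrightarrow> g \<in> T"
      using T f unfolding open_mps_def by blast
    ultimately show "\<exists>K. finite K \<and> (\<forall>g. (\<forall>m\<in>K. mps_coeff g m = mps_coeff f m) \<longrightarrow> g \<in> S \<inter> T)"
      by (intro exI[of _ "K \<union> L"]) auto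
  qed
next
  fix \<S> :: "('a, 'b) mps set set"
  assume "\<forall>S\<in>\<S>. open S"
  then show "open (\<Union>\<S>)"
    unfolding open_mps_def by (meson Union_iff)
next
  fix f g :: "('a, 'b) mps"
  assume "f \<noteq> g"
  then obtain m where m: "mps_coeff f m \<noteq> mps_coeff g m"
    using mps_eqI by blast
  have o: "open {h :: ('a, 'b) mps. mps_coeff h m = c}" for c
    unfolding open_mps_def by (auto intro!: exI[of _ "{m}"])
  show "\<exists>U V. open U \<and> open V \<and> f \<in> U \<and> g \<in> V \<and> U \<inter> V = {}"
    using m by (intro exI[of _ "{h. mps_coeff h m = mps_coeff f m}"]
                      exI[of _ "{h. mps_coeff h m = mps_coeff g m}"]) (auto simp: o)
qed

end

lemma tendsto_mps_iff:
  "(F \<longlongrightarrow> f) X \<longleftrightarrow> (\<forall>m. eventually (\<lambda>x. mps_coeff (F x) m = mps_coeff f m) X)"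
proof
  assume *: "(F \<longlongrightarrow> f) X"
  show "\<forall>m. eventually (\<lambda>x. mps_coeff (F x) m = mps_coeff f m) X"
  proof
    fix m
    have "open {h. mps_coeff h m = mps_coeff f m}"
      unfolding open_mps_def by (auto intro!: exI[of _ "{m}"])
    from topological_tendstoD[OF * this]
    show "eventually (\<lambda>x. mps_coeff (F x) m = mps_coeff f m) X" by simp
  qed
next
  assume *: "\<forall>m. eventually (\<lambda>x. mps_coeff (F x) m = mps_coeff f m) X"
  show "(F \<longlongrightarrow> f) X"
  proof (rule topological_tendstoI)
    fix S assume "open S" "f \<in> S"
    then obtain K where K: "finite K" "\<And>g. (\<forall>m\<in>K. mps_coeff g m = mps_coeff f m) \<Longrightarrow> g \<in> S"
      unfolding open_mps_def by blast
    have "eventually (\<lambda>x. \<forall>m\<in>K. mps_coeff (F x) m = mps_coeff f m) X"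
      using * K(1) by (simp add: eventually_ball_finite)
    then show "eventually (\<lambda>x. F x \<in> S) X"
      by (rule eventually_mono) (rule K(2))
  qed
qed

instance mps :: (type, comm_ring_1) topological_comm_monoid_add
proof
  fix f g :: "('a, 'b) mps"
  have 1: "eventually (\<lambda>x. mps_coeff (fst x) m = mps_coeff f m) (nhds f \<times>\<^sub>F nhds g)" for m
    using filterlim_fst[of "nhds f" "nhds g"] by (auto simp: tendsto_mps_iff)
  have 2: "eventually (\<lambda>x. mps_coeff (snd x) m = mps_coeff g m) (nhds f \<times>\<^sub>F nhds g)" for m
    using filterlim_snd[of "nhds g" "nhds f"] by (auto simp: tendsto_mps_iff)
  show "((\<lambda>x. fst x + snd x) \<longlongrightarrow> f + g) (nhds f \<times>\<^sub>F nhds g)"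
    unfolding tendsto_mps_iff
  proof
    fix m
    show "\<forall>\<^sub>F x in nhds f \<times>\<^sub>F nhds g. mps_coeff (fst x + snd x) m = mps_coeff (f + g) m"
      using 1[of m] 2[of m] by eventually_elim simp
  qed
qed

lemma has_sum_mps:
  assumes "\<And>m. finite {i \<in> I. mps_coeff (F i) m \<noteq> 0}"
  shows "(F has_sum Abs_mps (\<lambda>m. \<Sum>i | i \<in> I \<and> mps_coeff (F i) m \<noteq> 0. mps_coeff (F i) m)) I"
  unfolding has_sum_def tendsto_mps_iff
proof
  fix m
  let ?J = "{i \<in> I. mps_coeff (F i) m \<noteq> 0}"
  show "\<forall>\<^sub>F K in finite_subsets_at_top I. mps_coeff (sum F K) m =
    mps_coeff (Abs_mps (\<lambda>m. \<Sum>i | i \<in> I \<and> mps_coeff (F i) m \<noteq> 0. mps_coeff (F i) m)) m"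
    unfolding eventually_finite_subsets_at_top mps_coeff_Abs mps_coeff_sum
  proof (intro exI[of _ ?J] conjI allI impI)
    fix K assume K: "finite K \<and> ?J \<subseteq> K \<and> K \<subseteq> I"
    show "(\<Sum>i\<in>K. mps_coeff (F i) m) = (\<Sum>i\<in>?J. mps_coeff (F i) m)"
    proof (rule sum.mono_neutral_right)
      show "\<forall>i\<in>K - ?J. mps_coeff (F i) m = 0"
        using K by blast
    qed (use K in simp_all)
  qed (use assms in auto)
qed


section \<open>Exponentials, geometric series and powers of the determinant\<close>

text \<open>
  These are meant for series without constant term and matrices of such series; the summability
  lemmas below show that the \<^const>\<open>infsum\<close> terms then denote genuine sums.
\<close>

definition mps_exp :: "('v, 'a::field_char_0) mps \<Rightarrow> ('v, 'a) mps" where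
  "mps_exp f = (\<Sum>\<^sub>\<infinity>k. mps_const (1 / fact k) * f ^ k)"

text \<open>On \<^typ>\<open>'a ^ 'n ^ 'n\<close> the library's multiplication \<open>*\<close>, hence \<open>^\<close>, is componentwise.\<close>

definition mat_pow :: "'a::semiring_1 ^ 'n ^ 'n \<Rightarrow> nat \<Rightarrow> 'a ^ 'n ^ 'n" where
  "mat_pow A k = (((**) A) ^^ k) (mat 1)"

text \<open>\<open>(I - A)\<^sup>-\<^sup>1 = (\<Sum>k. A\<^sup>k)\<close>, summed entrywise.\<close>

definition inv_I_minus :: "('v, 'a::comm_ring_1) mps ^ 'n ^ 'n \<Rightarrow> ('v, 'a) mps ^ 'n ^ 'n" where
  "inv_I_minus A = (\<chi> i j. \<Sum>\<^sub>\<infinity>k. mat_pow A k $ i $ j)"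

text \<open>\<open>det (I - A)\<close> to the power \<open>-\<beta>\<close>, where \<open>\<beta>\<close> is itself a power series.\<close>

definition det_I_minus_powr_minus ::
    "('v, 'a::field_char_0) mps \<Rightarrow> ('v, 'a) mps ^ 'n ^ 'n \<Rightarrow> ('v, 'a) mps" where
  "det_I_minus_powr_minus \<beta> A =
     mps_exp (\<beta> * (\<Sum>\<^sub>\<infinity>t\<in>{1..}. mps_const (1 / of_nat t) * trace (mat_pow A t)))"


definition mdeg :: "('v \<Rightarrow>\<^sub>0 nat) \<Rightarrow> nat" where
  "mdeg m = Sum_any (Poly_Mapping.lookup m)"

lemma mdeg_add: "mdeg (a + b) = mdeg a + mdeg b"
  unfolding mdeg_def lookup_add by (rule Sum_any.distrib) simp_all

lemma mdeg_0 [simp]: "mdeg 0 = 0"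
  by (simp add: mdeg_def)

lemma mdeg_eq_0_iff: "mdeg m = 0 \<longleftrightarrow> m = 0"
proof
  assume "mdeg m = 0"
  then have "Poly_Mapping.lookup m x = 0" for x
    by (cases "Poly_Mapping.lookup m x = 0") (auto simp: mdeg_def Sum_any.expand_set)
  then show "m = 0"
    by (intro poly_mapping_eqI) auto
qed simp

definition ord_ge :: "nat \<Rightarrow> ('v, 'a::comm_ring_1) mps \<Rightarrow> bool" where
  "ord_ge k f \<longleftrightarrow> (\<forall>m. mdeg m < k \<longrightarrow> mps_coeff f m = 0)"

lemma ord_ge_mult: "ord_ge j f \<Longrightarrow> ord_ge k g \<Longrightarrow> ord_ge (j + k) (f * g)"
  unfolding ord_ge_def mps_coeff_mult splits_def
proof (intro allI impI sum.neutral ballI)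
  fix m :: "'a \<Rightarrow>\<^sub>0 nat" and x
  assume f: "\<forall>m. mdeg m < j \<longrightarrow> mps_coeff f m = 0" and g: "\<forall>m. mdeg m < k \<longrightarrow> mps_coeff g m = 0"
    and "mdeg m < j + k" "x \<in> {(a, b). a + b = m}"
  then have "mdeg (fst x) < j \<or> mdeg (snd x) < k"
    by (auto simp: mdeg_add)
  then show "(case x of (a, b) \<Rightarrow> mps_coeff f a * mps_coeff g b) = 0"
    using f g by (auto simp: case_prod_beta)
qed

lemma ord_ge_0 [simp]: "ord_ge 0 f"
  by (simp add: ord_ge_def)

lemma ord_ge_zero [simp]: "ord_ge k 0"
  by (simp add: ord_ge_def)

lemma ord_ge_sum: "(\<And>i. i \<in> I \<Longrightarrow> ord_ge k (F i)) \<Longrightarrow> ord_ge k (sum F I)"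
  by (auto simp: ord_ge_def intro!: sum.neutral)

lemma ord_ge_1_iff: "ord_ge 1 f \<longleftrightarrow> mps_coeff f 0 = 0"
  by (auto simp: ord_ge_def mdeg_eq_0_iff)

lemma ord_ge_power: "ord_ge 1 f \<Longrightarrow> ord_ge k (f ^ k)"
  using ord_ge_mult[of 1 f] by (induction k) auto

lemma ord_ge_mat_pow:
  assumes "\<And>i j. ord_ge 1 (A $ i $ j)"
  shows "ord_ge k (mat_pow A k $ i $ j)"
proof (induction k arbitrary: i j)
  case (Suc k)
  have "mat_pow A (Suc k) $ i $ j = (\<Sum>l\<in>UNIV. A $ i $ l * mat_pow A k $ l $ j)"
    by (simp add: mat_pow_def matrix_matrix_mult_def)
  also have "ord_ge (Suc k) \<dots>"
    using ord_ge_mult[OF assms Suc.IH] by (intro ord_ge_sum) simp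
  finally show ?case .
qed simp

lemma summable_on_mps_ord_ge:
  assumes "\<And>k. ord_ge k (F k)"
  shows "F summable_on I"
proof -
  have "finite {k \<in> I. mps_coeff (F k) m \<noteq> 0}" for m
  proof (rule finite_subset)
    show "{k \<in> I. mps_coeff (F k) m \<noteq> 0} \<subseteq> {..mdeg m}"
      using assms by (auto simp: ord_ge_def not_le[symmetric])
  qed simp
  then show ?thesis
    unfolding summable_on_def by (blast intro: has_sum_mps)
qed

lemma mps_exp_summable:
  assumes "mps_coeff f 0 = 0"
  shows "(\<lambda>k. mps_const (1 / fact k) * f ^ k) summable_on UNIV"
proof (rule summable_on_mps_ord_ge)
  have "ord_ge 1 f"
    using assms by (rule ord_ge_1_iff[THEN iffD2])
  from ord_ge_mult[OF ord_ge_0 ord_ge_power[OF this]]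
  show "ord_ge k (mps_const (1 / fact k) * f ^ k)" for k
    by simp
qed

lemma inv_I_minus_summable:
  assumes "\<And>i j. mps_coeff (A $ i $ j) 0 = 0"
  shows "(\<lambda>k. mat_pow A k $ i $ j) summable_on UNIV"
  by (intro summable_on_mps_ord_ge ord_ge_mat_pow ord_ge_1_iff[THEN iffD2] assms)

lemma log_det_summable:
  assumes "\<And>i j. mps_coeff (A $ i $ j) 0 = 0"
  shows "(\<lambda>t. mps_const (1 / of_nat t) * trace (mat_pow A t)) summable_on I"
proof (intro summable_on_mps_ord_ge)
  fix t
  have "ord_ge t (trace (mat_pow A t))"
    unfolding trace_def by (intro ord_ge_sum ord_ge_mat_pow ord_ge_1_iff[THEN iffD2] assms)
  then show "ord_ge t (mps_const (1 / of_nat t) * trace (mat_pow A t))"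
    using ord_ge_mult[OF ord_ge_0] by fastforce
qed


section \<open>Partial permutations and the extended partial permanent\<close>

definition partial_perms :: "'x set \<Rightarrow> ('x \<rightharpoonup> 'x) set" where
  "partial_perms X = {\<psi>. dom \<psi> \<subseteq> X \<and> ran \<psi> \<subseteq> X \<and> inj_on \<psi> (dom \<psi>)}"

definition perm_core :: "('x \<rightharpoonup> 'x) \<Rightarrow> 'x set" where
  "perm_core \<psi> = \<Union>{S. S \<subseteq> dom \<psi> \<and> bij_betw (the \<circ> \<psi>) S S}"

text \<open>The union is itself one of the sets, so it is the largest of them.\<close>

lemma perm_core_bij_betw:
  assumes "\<psi> \<in> partial_perms X"
  shows "perm_core \<psi> \<subseteq> dom \<psi>" "bij_betw (the \<circ> \<psi>) (perm_core \<psi>) (perm_core \<psi>)"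
proof -
  show sub: "perm_core \<psi> \<subseteq> dom \<psi>"
    by (auto simp: perm_core_def)
  have "inj_on (the \<circ> \<psi>) (dom \<psi>)"
    using assms by (auto simp: partial_perms_def inj_on_def dom_def)
  then have "inj_on (the \<circ> \<psi>) (perm_core \<psi>)"
    using sub by (rule inj_on_subset)
  moreover have "(the \<circ> \<psi>) ` perm_core \<psi> = perm_core \<psi>"
  proof -
    have "(`) (the \<circ> \<psi>) ` {S. S \<subseteq> dom \<psi> \<and> bij_betw (the \<circ> \<psi>) S S}
        = (\<lambda>S. S) ` {S. S \<subseteq> dom \<psi> \<and> bij_betw (the \<circ> \<psi>) S S}"
      by (rule image_cong) (auto simp only: mem_Collect_eq bij_betw_def)
    then show ?thesis
      unfolding perm_core_def image_Union by simp
  qed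
  ultimately show "bij_betw (the \<circ> \<psi>) (perm_core \<psi>) (perm_core \<psi>)"
    by (simp add: bij_betw_def)
qed

text \<open>Each cycle of a permutation of a finite set is counted through its orbit.\<close>

definition num_cycles :: "('x \<rightharpoonup> 'x) \<Rightarrow> nat" where
  "num_cycles \<psi> = card (orbit (perm_restrict (the \<circ> \<psi>) (perm_core \<psi>)) ` perm_core \<psi>)"

definition pperm ::
    "'b::comm_ring_1 \<Rightarrow> ('x \<Rightarrow> 'b) \<Rightarrow> ('x \<Rightarrow> 'b) \<Rightarrow> 'x set \<Rightarrow> ('x \<Rightarrow> 'x \<Rightarrow> 'b) \<Rightarrow> 'b" where
  "pperm \<beta> \<theta> \<phi> X M =
     (\<Sum>\<psi>\<in>partial_perms X.
        \<beta> ^ num_cycles \<psi> * (\<Prod>x\<in>dom \<psi>. M x (the (\<psi> x)))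
          * (\<Prod>y\<in>X - ran \<psi>. \<theta> y) * (\<Prod>z\<in>X - dom \<psi>. \<phi> z))"

text \<open>The labelled copy \<open>i\<^sub>a\<close> of the index \<open>i\<close> is the pair \<open>(i, a)\<close>.\<close>

definition copies :: "nat ^ 'n \<Rightarrow> ('n \<times> nat) set" where
  "copies r = (SIGMA i:UNIV. {1..r $ i})"

definition pperm_copies ::
    "'b::comm_ring_1 \<Rightarrow> 'b ^ 'n \<Rightarrow> 'b ^ 'n \<Rightarrow> 'b ^ 'n ^ 'n \<Rightarrow> nat ^ 'n \<Rightarrow> 'b" where
  "pperm_copies \<beta> \<theta> \<phi> A r =
     pperm \<beta> (\<lambda>(i, a). \<theta> $ i) (\<lambda>(i, a). \<phi> $ i) (copies r) (\<lambda>(i, a) (j, b). A $ i $ j)"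

datatype 'n indet = Beta | Entry 'n 'n | Theta 'n | Phi 'n

end

theory Submission
  imports Defs
begin

text \<open>
  Both sides of the identity solve the same linear differential equation in the ring of power series,
  and this equation has only one solution with given coefficients at the monomials in \<open>\<beta>\<close> and \<open>\<phi>\<close>
  alone.

  Write \<open>P r\<close> for the partial permanent of the matrix in which the index \<open>i\<close> is repeated \<open>r $ i\<close>
  times, and \<open>F\<close> for the sum of all \<open>P r / r!\<close>. A partial permutation consists of cycles and
  chains. It is a set of links: its arrows \<open>u \<rightarrow> v\<close>, with weight \<open>A u v\<close>; a link from outside to the
  first point \<open>v\<close> of each chain, with weight \<open>\<theta> v\<close>; and a link from the last point \<open>u\<close> of each chain to
  the outside, with weight \<open>\<phi> u\<close>. A partial permutation with an additional point \<open>x\<close> arises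
  from one without it in exactly one of these ways: \<open>x\<close> becomes a fixed point (factor \<open>\<beta> A x x\<close>),
  \<open>x\<close> becomes a chain of its own (factor \<open>\<theta> x \<phi> x\<close>), or \<open>x\<close> subdivides one of the links, which
  leaves the number of cycles unchanged. The Leibniz rule turns the sum over these links
  into a derivation: if \<open>D\<^sub>i\<close> is the derivation of the power series ring with
  \<open>D\<^sub>i (A u v) = A u i A i v\<close>, \<open>D\<^sub>i (\<theta> v) = \<theta> i A i v\<close>, \<open>D\<^sub>i (\<phi> u) = A u i \<phi> i\<close> and \<open>D\<^sub>i \<beta> = 0\<close>, then
  one more copy of \<open>i\<close> changes \<open>P r\<close> into \<open>(\<beta> A i i + \<theta> i \<phi> i) P r + D\<^sub>i (P r)\<close>. This is
  \<open>pperm_insert\<close>, which rests on \<open>sum_insert_at\<close>, \<open>links_insert_at\<close> and \<open>card_cycles_of_bypass\<close>.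

  Let \<open>E\<close> be the Euler derivation that multiplies a monomial by the number of its factors \<open>A u v\<close> and
  \<open>\<theta> v\<close>. As every point has one incoming link, \<open>E\<close> multiplies \<open>P r\<close> by the number of points
  (\<open>eigen_pperm\<close>). Summing the recursion over all \<open>r\<close> and \<open>i\<close> gives
  \<open>E F = (\<beta> Tr A + \<theta> \<phi>\<^sup>T) F + D F\<close> with \<open>D\<close> the sum of the \<open>D\<^sub>i\<close> (\<open>pperm_series_equation\<close>).

  The right-hand side is the exponential of the sum \<open>G\<close> of the series
  \<open>g\<^sub>k = \<theta> A\<^sup>k \<phi>\<^sup>T + \<beta> Tr (A\<^bsup>k + 1\<^esup>) / (k + 1)\<close>. Now \<open>D A = A\<^sup>2\<close>, \<open>D \<theta> = \<theta> A\<close> and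
  \<open>D \<phi>\<^sup>T = A \<phi>\<^sup>T\<close>, so that \<open>D g\<^sub>k = (k + 2) g\<^bsub>k + 1\<^esub>\<close>, while \<open>E g\<^sub>k = (k + 1) g\<^sub>k\<close>. Hence
  \<open>E G = g\<^sub>0 + D G\<close>, and \<open>exp G\<close> solves the same equation, since \<open>g\<^sub>0 = \<beta> Tr A + \<theta> \<phi>\<^sup>T\<close>.

  Finally \<open>D\<close> and the multiplication by \<open>g\<^sub>0\<close> raise the total degree, so the equation determines
  a solution by induction on the degree from its coefficients at the monomials that \<open>E\<close>
  annihilates (\<open>euler_unique\<close>). There both series have the coefficients of \<open>1\<close>.
\<close>

section \<open>Derivations of commutative rings\<close>

text \<open>
  The insertion recursion for the partial permanent holds for any derivation of a commutative ring
  with the right values on the matrix entries, so derivations are first treated without reference to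
  power series.
\<close>

locale derivation =
  fixes d :: "'a::comm_ring_1 \<Rightarrow> 'a"
  assumes add: "d (f + g) = d f + d g"
    and mult: "d (f * g) = d f * g + f * d g"
begin

lemma zero [simp]: "d 0 = 0"
  using add[of 0 0] by simp

lemma one [simp]: "d 1 = 0"
  using mult[of 1 1] by simp

lemma sum: "d (sum F I) = (\<Sum>i\<in>I. d (F i))"
  by (induction I rule: infinite_finite_induct) (auto simp: add)

lemma power: "d (f ^ k) = of_nat k * f ^ (k - 1) * d f"
proof (induction k)
  case (Suc k)
  then show ?case
    by (cases k) (simp_all add: mult algebra_simps)
qed simp

lemma prod: "finite I \<Longrightarrow> d (prod F I) = (\<Sum>i\<in>I. d (F i) * prod F (I - {i}))"
proof (induction I rule: finite_induct)
  case (insert x I)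
  have "insert x I - {i} = insert x (I - {i})" if "i \<in> I" for i
    using that insert.hyps by auto
  then have "(\<Sum>i\<in>I. d (F i) * prod F (insert x I - {i})) =
      F x * (\<Sum>i\<in>I. d (F i) * prod F (I - {i}))"
    unfolding sum_distrib_left using insert.hyps by (intro sum.cong) (auto simp: mult_ac)
  moreover have "insert x I - {x} = I"
    using insert.hyps by auto
  ultimately show ?case
    using insert by (simp add: mult)
qed simp

lemma eigen_mult:
  "d f = of_nat a * f \<Longrightarrow> d g = of_nat b * g \<Longrightarrow> d (f * g) = of_nat (a + b) * (f * g)"
  by (simp add: mult algebra_simps)

lemma eigen_prod:
  assumes "\<And>i. i \<in> I \<Longrightarrow> d (F i) = of_nat a * F i"
  shows "d (prod F I) = of_nat (a * card I) * prod F I"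
  using assms by (induction I rule: infinite_finite_induct) (auto simp: mult algebra_simps)

end

section \<open>Coefficients and infinite sums of power series\<close>

lemma mps_coeff_const_mult [simp]: "mps_coeff (mps_const c * f) m = c * mps_coeff f m"
  for f :: "('v, 'a::comm_ring_1) mps"
proof -
  have "mps_coeff (mps_const c * f) m =
      (\<Sum>(a, b)\<in>{(0 :: 'v \<Rightarrow>\<^sub>0 nat, m)}. mps_coeff (mps_const c) a * mps_coeff f b)"
    unfolding mps_coeff_mult
    by (intro sum.mono_neutral_right finite_splits) (auto simp: splits_def mps_const_def split: if_splits)
  then show ?thesis by (simp add: mps_const_def)
qed

lemma mps_const_1: "mps_const 1 = 1"
  by (rule mps_eqI) (simp add: mps_const_def mps_coeff_one)

lemma mps_const_mult: "mps_const a * mps_const b = mps_const (a * b)"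
  by (rule mps_eqI) (simp, simp add: mps_const_def)

lemma mps_const_of_nat: "mps_const (of_nat k) = (of_nat k :: ('v, 'a::comm_ring_1) mps)"
proof (induction k)
  case 0
  show ?case by (rule mps_eqI) (simp add: mps_const_def)
next
  case (Suc k)
  have "mps_const (of_nat (Suc k)) = (1 + mps_const (of_nat k) :: ('v, 'a) mps)"
    by (rule mps_eqI) (simp add: mps_const_def mps_coeff_one)
  also have "\<dots> = of_nat (Suc k)"
    using Suc by simp
  finally show ?case .
qed

lemma mps_coeff_of_nat_mult [simp]: "mps_coeff (of_nat k * f) m = of_nat k * mps_coeff f m"
  unfolding mps_const_of_nat[symmetric] by simp

lemma mps_coeff_diff [simp]: "mps_coeff (f - g) m = mps_coeff f m - mps_coeff g m"
  by (simp add: minus_mps.rep_eq)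

text \<open>
  Coefficients are discrete: near \<^term>\<open>f\<close> each single coefficient is constant. An operator for which
  every coefficient of the result depends on finitely many coefficients of the argument is therefore
  continuous; multiplication, partial derivatives and the Euler operator below are all of this kind.
\<close>

lemma eventually_mps_coeff_nhds: "\<forall>\<^sub>F g in nhds f. mps_coeff g m = mps_coeff f m"
  using filterlim_ident[of "nhds f"] by (simp add: tendsto_mps_iff)

lemma mps_mult_left_cont: "filterlim ((*) c) (nhds (c * f)) (nhds f)"
  for c f :: "('v, 'a::comm_ring_1) mps"
  unfolding tendsto_mps_iff
proof
  fix m
  have "\<forall>\<^sub>F g in nhds f. \<forall>x\<in>splits m. mps_coeff g (snd x) = mps_coeff f (snd x)"
    by (intro eventually_ball_finite ballI eventually_mps_coeff_nhds) simp
  then show "\<forall>\<^sub>F g in nhds f. mps_coeff (c * g) m = mps_coeff (c * f) m"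
    by eventually_elim (auto simp: mps_coeff_mult intro!: sum.cong)
qed

lemma has_sum_mps_mult_left:
  fixes c :: "('v, 'a::comm_ring_1) mps"
  assumes "(F has_sum s) I"
  shows "((\<lambda>i. c * F i) has_sum (c * s)) I"
  using filterlim_compose[OF mps_mult_left_cont assms[unfolded has_sum_def]]
  by (simp add: has_sum_def sum_distrib_left)

text \<open>
  One coefficient of an infinite sum is a coefficient of a finite partial sum, which may be chosen
  to contain any prescribed finite set of indices.
\<close>

lemma has_sum_mps_coeffE:
  fixes F :: "'i \<Rightarrow> ('v, 'a::comm_ring_1) mps"
  assumes "(F has_sum s) I" "finite J" "J \<subseteq> I"
  obtains K where "finite K" "J \<subseteq> K" "K \<subseteq> I" "mps_coeff s m = (\<Sum>i\<in>K. mps_coeff (F i) m)"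
proof -
  have "\<forall>\<^sub>F K in finite_subsets_at_top I. mps_coeff (sum F K) m = mps_coeff s m"
    using assms(1) by (simp add: has_sum_def tendsto_mps_iff)
  then obtain L where "finite L" "L \<subseteq> I"
    "\<And>K. finite K \<Longrightarrow> L \<subseteq> K \<Longrightarrow> K \<subseteq> I \<Longrightarrow> mps_coeff (sum F K) m = mps_coeff s m"
    unfolding eventually_finite_subsets_at_top by metis
  then show ?thesis
    using assms(2,3) by (intro that[of "J \<union> L"]) (auto simp flip: mps_coeff_sum)
qed

section \<open>Continuous derivations of power series\<close>

text \<open>
  Continuity is what makes the termwise differentiation of infinite sums legitimate, in particular
  that of the exponential series.
\<close>

locale mps_derivation = derivation d for d :: "('v, 'a::field_char_0) mps \<Rightarrow> ('v, 'a) mps" +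
  assumes const: "d (mps_const c) = 0"
    and cont: "filterlim d (nhds (d f)) (nhds f)"
begin

lemma const_mult: "d (mps_const c * f) = mps_const c * d f"
  by (simp add: mult const)

lemma has_sum:
  assumes "(F has_sum s) I"
  shows "((\<lambda>i. d (F i)) has_sum d s) I"
  using filterlim_compose[OF cont assms[unfolded has_sum_def]]
  by (simp add: has_sum_def sum)

lemma exp:
  assumes "mps_coeff f 0 = 0"
  shows "d (mps_exp f) = d f * mps_exp f"
proof -
  let ?e = "\<lambda>k. mps_const (1 / fact k) * f ^ k"
  have e: "(?e has_sum mps_exp f) UNIV"
    unfolding mps_exp_def by (rule has_sum_infsum[OF mps_exp_summable[OF assms]])
  have de: "d (?e k) = (if k = 0 then 0 else d f * ?e (k - 1))" for k
  proof (cases k)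
    case (Suc j)
    have "mps_const (1 / fact k) * of_nat k = (mps_const (1 / fact j) :: ('v, 'a) mps)"
      unfolding mps_const_of_nat[symmetric] mps_const_mult Suc
      by (simp add: divide_simps del: of_nat_Suc)
    moreover have "d (?e k) = (mps_const (1 / fact k) * of_nat k) * (f ^ j * d f)"
      unfolding const_mult power by (simp only: Suc diff_Suc_1 mult.assoc)
    ultimately show ?thesis
      using Suc by (simp only: mult_ac) simp
  qed (simp add: const)
  have "((\<lambda>k. d (?e k)) has_sum (d f * mps_exp f)) (range Suc)"
    by (subst has_sum_reindex) (auto simp: o_def de intro!: has_sum_mps_mult_left e)
  then have "((\<lambda>k. d (?e k)) has_sum (d f * mps_exp f)) UNIV"
    by (rule has_sum_cong_neutral[THEN iffD1, rotated -1])
      (auto simp: de image_iff gr0_conv_Suc)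
  then show ?thesis
    using has_sum[OF e] has_sum_unique by blast
qed

end

definition mps_partial :: "'v \<Rightarrow> ('v, 'a::comm_ring_1) mps \<Rightarrow> ('v, 'a) mps" where
  "mps_partial v f = Abs_mps (\<lambda>m.
     of_nat (Suc (Poly_Mapping.lookup m v)) * mps_coeff f (m + Poly_Mapping.single v 1))"

lemma mps_coeff_partial [simp]:
  "mps_coeff (mps_partial v f) m =
     of_nat (Suc (Poly_Mapping.lookup m v)) * mps_coeff f (m + Poly_Mapping.single v 1)"
  by (simp add: mps_partial_def)

text \<open>
  Differentiating the first factor multiplies each term of the product by the exponent of
  \<^term>\<open>v\<close> in the monomial taken from that factor. The terms with exponent \<open>0\<close> drop out, which is why the splittings
  of \<^term>\<open>m + Poly_Mapping.single v 1\<close> may be replaced by those of \<^term>\<open>m\<close>. The Leibniz rule follows,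
  since the exponents of \<^term>\<open>v\<close> in the two monomials add up to the exponent in the product.
\<close>

lemma mps_coeff_partial_mult:
  fixes f g :: "('v, 'a::comm_ring_1) mps"
  shows "mps_coeff (mps_partial v f * g) m =
    (\<Sum>(a, b)\<in>splits (m + Poly_Mapping.single v 1).
       of_nat (Poly_Mapping.lookup a v) * (mps_coeff f a * mps_coeff g b))"
proof -
  let ?e = "Poly_Mapping.single v (1::nat)"
  let ?h = "\<lambda>(a, b). (a + ?e, b)"
  let ?t = "\<lambda>(a, b). of_nat (Poly_Mapping.lookup a v) * (mps_coeff f a * mps_coeff g b)"
  have "sum ?t (splits (m + ?e)) = sum ?t (?h ` splits m)"
  proof (rule sum.mono_neutral_right)
    show "?h ` splits m \<subseteq> splits (m + ?e)"
      by (auto simp: splits_def ac_simps)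
    show "\<forall>x\<in>splits (m + ?e) - ?h ` splits m. ?t x = 0"
    proof (intro ballI, elim DiffE, unfold split_paired_all prod.case)
      fix a b assume "(a, b) \<in> splits (m + ?e)" and "(a, b) \<notin> ?h ` splits m"
      then have ab: "a + b = m + ?e" "(a, b) \<notin> ?h ` {(a, b). a + b = m}"
        by (simp_all add: splits_def)
      have "Poly_Mapping.lookup a v = 0"
      proof (rule ccontr)
        assume "Poly_Mapping.lookup a v \<noteq> 0"
        then have a: "a = (a - ?e) + ?e"
          by (intro poly_mapping_eqI) (auto simp: lookup_add lookup_minus lookup_single when_def)
        then have "(a - ?e) + b = m"
          using ab(1) by (metis add.commute add.left_commute add_left_imp_eq)
        then show False
          using a ab(2) by force
      qed
      then show "of_nat (Poly_Mapping.lookup a v) * (mps_coeff f a * mps_coeff g b) = 0"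
        by simp
    qed
  qed simp
  also have "\<dots> = sum (?t \<circ> ?h) (splits m)"
    by (rule sum.reindex) (auto simp: inj_on_def)
  also have "\<dots> = mps_coeff (mps_partial v f * g) m"
    unfolding mps_coeff_mult by (intro sum.cong) (auto simp: lookup_add mult.assoc)
  finally show ?thesis ..
qed

lemma mps_partial_add: "mps_partial v (f + g) = mps_partial v f + mps_partial v g"
  by (rule mps_eqI) (simp add: algebra_simps)

lemma mps_partial_mult:
  fixes f g :: "('v, 'a::comm_ring_1) mps"
  shows "mps_partial v (f * g) = mps_partial v f * g + f * mps_partial v g"
proof (rule mps_eqI)
  fix m :: "'v \<Rightarrow>\<^sub>0 nat"
  let ?e = "Poly_Mapping.single v (1::nat)"
  have "mps_coeff (f * mps_partial v g) m = mps_coeff (mps_partial v g * f) m"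
    by (simp only: mult.commute)
  also have "\<dots> = (\<Sum>(a, b)\<in>splits (m + ?e).
       of_nat (Poly_Mapping.lookup b v) * (mps_coeff f a * mps_coeff g b))"
    unfolding mps_coeff_partial_mult
    by (rule sum.reindex_bij_witness[where i = prod.swap and j = prod.swap])
       (auto simp: splits_def ac_simps)
  finally have "mps_coeff (mps_partial v f * g + f * mps_partial v g) m =
    (\<Sum>(a, b)\<in>splits (m + ?e). of_nat (Poly_Mapping.lookup a v + Poly_Mapping.lookup b v)
        * (mps_coeff f a * mps_coeff g b))"
    by (simp add: mps_coeff_partial_mult sum.distrib[symmetric] case_prod_beta distrib_right)
  also have "\<dots> = (\<Sum>(a, b)\<in>splits (m + ?e). of_nat (Suc (Poly_Mapping.lookup m v))
        * (mps_coeff f a * mps_coeff g b))"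
  proof (intro sum.cong refl, unfold split_paired_all prod.case)
    fix a b assume "(a, b) \<in> splits (m + ?e)"
    then have "a + b = m + ?e"
      by (simp add: splits_def)
    then have "Poly_Mapping.lookup (a + b) v = Poly_Mapping.lookup (m + ?e) v" by simp
    then show "of_nat (Poly_Mapping.lookup a v + Poly_Mapping.lookup b v) * (mps_coeff f a * mps_coeff g b) =
        of_nat (Suc (Poly_Mapping.lookup m v)) * (mps_coeff f a * mps_coeff g b)"
      by (simp add: lookup_add)
  qed
  also have "\<dots> = mps_coeff (mps_partial v (f * g)) m"
    by (simp add: mps_coeff_mult sum_distrib_left case_prod_beta del: of_nat_Suc)
  finally show "mps_coeff (mps_partial v (f * g)) m = mps_coeff (mps_partial v f * g + f * mps_partial v g) m" ..
qed

lemma add_single_neq_0 [simp]: "m + Poly_Mapping.single v (1::nat) \<noteq> 0"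
proof
  assume "m + Poly_Mapping.single v (1::nat) = 0"
  then have "Poly_Mapping.lookup (m + Poly_Mapping.single v (1::nat)) v = 0" by simp
  then show False by (simp add: lookup_add)
qed

lemma mps_partial_const: "mps_partial v (mps_const c) = 0"
proof (rule mps_eqI)
  fix m
  show "mps_coeff (mps_partial v (mps_const c)) m = mps_coeff 0 m"
    using add_single_neq_0[of m v] by (simp add: mps_const_def)
qed

lemma mps_partial_indet: "mps_partial v (mps_indet u) = (if u = v then 1 else 0)"
proof (rule mps_eqI)
  fix m :: "'a \<Rightarrow>\<^sub>0 nat"
  have "m + Poly_Mapping.single v 1 = Poly_Mapping.single u 1 \<longleftrightarrow> u = v \<and> m = 0"
  proof
    assume *: "m + Poly_Mapping.single v 1 = Poly_Mapping.single u 1"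
    then have "Poly_Mapping.lookup (m + Poly_Mapping.single v 1) v =
        Poly_Mapping.lookup (Poly_Mapping.single u 1) v"
      by simp
    then have "u = v"
      by (simp add: lookup_add lookup_single when_def split: if_splits)
    then show "u = v \<and> m = 0" using * by simp
  qed auto
  then show "mps_coeff (mps_partial v (mps_indet u)) m = mps_coeff (if u = v then 1 else 0 :: ('a, 'b) mps) m"
    by (auto simp: mps_indet_def mps_coeff_one)
qed

lemma mps_partial_cont: "filterlim (mps_partial v) (nhds (mps_partial v f)) (nhds f)"
  unfolding tendsto_mps_iff
proof
  fix m
  show "\<forall>\<^sub>F g in nhds f. mps_coeff (mps_partial v g) m = mps_coeff (mps_partial v f) m"
    using eventually_mps_coeff_nhds[where f = f and m = "m + Poly_Mapping.single v 1"] by eventually_elim simp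
qed

lemma mdeg_single [simp]: "mdeg (Poly_Mapping.single v k) = k"
proof -
  have "{x. (if v = x then k else 0) \<noteq> 0} \<subseteq> {v}" by auto
  then show ?thesis
    unfolding mdeg_def by (subst Sum_any.expand_superset[of "{v}"]) (auto simp: lookup_single when_def)
qed

lemma ord_ge_partial: "ord_ge (Suc k) f \<Longrightarrow> ord_ge k (mps_partial v f)"
  by (auto simp: ord_ge_def mdeg_add)

text \<open>
  The derivation with prescribed values on the indeterminates, as \<open>vector_field_indet\<close> confirms.
\<close>

definition vector_field :: "('v::finite \<Rightarrow> ('v, 'a::comm_ring_1) mps) \<Rightarrow> ('v, 'a) mps \<Rightarrow> ('v, 'a) mps" where
  "vector_field a f = (\<Sum>v\<in>UNIV. a v * mps_partial v f)"

lemma mps_derivation_vector_field: "mps_derivation (vector_field (a :: 'v::finite \<Rightarrow> ('v, 'a::field_char_0) mps))"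
proof
  fix f g :: "('v, 'a) mps" and c :: 'a
  show "vector_field a (f + g) = vector_field a f + vector_field a g"
    by (simp add: vector_field_def mps_partial_add distrib_left sum.distrib)
  show "vector_field a (f * g) = vector_field a f * g + f * vector_field a g"
    by (simp add: vector_field_def mps_partial_mult distrib_left sum.distrib
        sum_distrib_left sum_distrib_right mult_ac)
  show "vector_field a (mps_const c) = 0"
    by (simp add: vector_field_def mps_partial_const)
  show "filterlim (vector_field a) (nhds (vector_field a f)) (nhds f)"
    unfolding vector_field_def
    by (intro tendsto_sum filterlim_compose[OF mps_mult_left_cont] mps_partial_cont)
qed

lemma vector_field_indet [simp]: "vector_field a (mps_indet v) = a v"
  by (simp add: vector_field_def mps_partial_indet if_distrib cong: if_cong)

lemma vector_field_sum: "vector_field (\<lambda>v. \<Sum>i\<in>I. a i v) f = (\<Sum>i\<in>I. vector_field (a i) f)"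
  by (simp add: vector_field_def sum_distrib_right sum.swap[of _ I])

definition weight :: "('v::finite \<Rightarrow> nat) \<Rightarrow> ('v \<Rightarrow>\<^sub>0 nat) \<Rightarrow> nat" where
  "weight w m = (\<Sum>v\<in>UNIV. w v * Poly_Mapping.lookup m v)"

lemma weight_add: "weight w (a + b) = weight w a + weight w b"
  by (simp add: weight_def lookup_add distrib_left sum.distrib)

lemma weight_0 [simp]: "weight w 0 = 0"
  by (simp add: weight_def)

lemma weight_single [simp]: "weight w (Poly_Mapping.single v k) = w v * k"
  by (simp add: weight_def lookup_single when_def if_distrib cong: if_cong)

text \<open>
  The Euler derivation of a weighted grading: it has the homogeneous series of weight \<open>k\<close> as
  eigenvectors with eigenvalue \<open>k\<close>, and so turns statements about degrees into equations.
\<close>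

definition euler :: "('v::finite \<Rightarrow> nat) \<Rightarrow> ('v, 'a::comm_ring_1) mps \<Rightarrow> ('v, 'a) mps" where
  "euler w f = Abs_mps (\<lambda>m. of_nat (weight w m) * mps_coeff f m)"

lemma mps_coeff_euler [simp]: "mps_coeff (euler w f) m = of_nat (weight w m) * mps_coeff f m"
  by (simp add: euler_def)

lemma mps_derivation_euler: "mps_derivation (euler w :: ('v::finite, 'a::field_char_0) mps \<Rightarrow> _)"
proof
  fix f g :: "('v, 'a) mps" and c :: 'a
  show "euler w (f + g) = euler w f + euler w g"
    by (rule mps_eqI) (simp add: algebra_simps)
  show "euler w (f * g) = euler w f * g + f * euler w g"
  proof (rule mps_eqI)
    fix m
    show "mps_coeff (euler w (f * g)) m = mps_coeff (euler w f * g + f * euler w g) m"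
      unfolding mps_coeff_add mps_coeff_mult mps_coeff_euler sum_distrib_left sum.distrib[symmetric]
      by (rule sum.cong) (auto simp: splits_def weight_add algebra_simps)
  qed
  show "euler w (mps_const c) = 0"
    by (rule mps_eqI) (simp add: mps_const_def)
  show "filterlim (euler w) (nhds (euler w f)) (nhds f)"
    unfolding tendsto_mps_iff
  proof
    fix m
    show "\<forall>\<^sub>F g in nhds f. mps_coeff (euler w g) m = mps_coeff (euler w f) m"
      using eventually_mps_coeff_nhds[where f = f and m = m] by eventually_elim simp
  qed
qed

lemma euler_indet: "euler w (mps_indet v) = of_nat (w v) * mps_indet v"
  by (rule mps_eqI) (simp add: mps_indet_def)

lemma euler_eigen_coeff:
  fixes f :: "('v::finite, 'a::field_char_0) mps"
  assumes "euler w f = of_nat k * f" "weight w m \<noteq> k"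
  shows "mps_coeff f m = 0"
proof -
  have "of_nat (weight w m) * mps_coeff f m = of_nat k * mps_coeff f m"
    using arg_cong[OF assms(1), of "\<lambda>f. mps_coeff f m"] by simp
  then show ?thesis using assms(2) by simp
qed

section \<open>Uniqueness for a first-order equation\<close>

text \<open>
  The right-hand side \<open>c * F + vector_field a F\<close> has larger order than \<open>F\<close>: multiplication by
  \<open>c\<close> raises the order, while \<open>vector_field a\<close> takes away one indeterminate and puts in a series
  of order two. Comparing coefficients at \<open>m\<close> therefore expresses \<open>weight w m\<close> times the coefficient
  of \<open>F\<close> through coefficients of lower degree, and induction on the total degree leaves only the
  monomials of weight \<open>0\<close> undetermined.
\<close>

lemma euler_unique:
  fixes F R :: "('v::finite, 'a::field_char_0) mps"
  assumes a: "\<And>v. ord_ge 2 (a v)" and c: "ord_ge 1 c"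
    and F: "euler w F = c * F + vector_field a F"
    and R: "euler w R = c * R + vector_field a R"
    and base: "\<And>m. weight w m = 0 \<Longrightarrow> mps_coeff F m = mps_coeff R m"
  shows "F = R"
proof -
  interpret E: mps_derivation "euler w :: ('v, 'a) mps \<Rightarrow> _" by (rule mps_derivation_euler)
  interpret D: mps_derivation "vector_field a" by (rule mps_derivation_vector_field)
  let ?H = "F - R"
  have "euler w ?H = euler w F - euler w R" "vector_field a ?H = vector_field a F - vector_field a R"
    using E.add[of ?H R] D.add[of ?H R] by (simp_all add: eq_diff_eq)
  then have H: "euler w ?H = c * ?H + vector_field a ?H"
    using F R by (simp only: right_diff_distrib) simp
  have "ord_ge k ?H" for k
  proof (induction k)
    case (Suc k)
    show ?case
      unfolding ord_ge_def
    proof (intro allI impI)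
      fix m :: "'v \<Rightarrow>\<^sub>0 nat" assume m: "mdeg m < Suc k"
      have 1: "ord_ge (Suc k) (c * ?H)"
        using ord_ge_mult[OF c Suc] by simp
      have 2: "ord_ge (Suc k) (a v * mps_partial v ?H)" for v
      proof (cases k)
        case 0
        then show ?thesis using ord_ge_mult[OF a, of 0 "mps_partial v ?H" v] by (simp add: ord_ge_def)
      next
        case (Suc j)
        then show ?thesis
          using ord_ge_mult[OF a ord_ge_partial, of j ?H v v] \<open>ord_ge k ?H\<close> by simp
      qed
      have "mps_coeff (c * ?H + vector_field a ?H) m = 0"
        using 1 2 m unfolding vector_field_def ord_ge_def by (simp del: mps_coeff_diff)
      then have "of_nat (weight w m) * mps_coeff ?H m = 0"
        using arg_cong[OF H, of "\<lambda>f. mps_coeff f m"] by simp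
      then show "mps_coeff ?H m = 0"
        using base by (cases "weight w m = 0") auto
    qed
  qed simp
  then have "mps_coeff ?H m = 0" for m
    unfolding ord_ge_def by (meson lessI)
  then show ?thesis by (intro mps_eqI) auto
qed

section \<open>Cycles of a relation\<close>

text \<open>
  For the graph of a partial permutation these are the point sets of its cycles. The formulation
  through the transitive closure avoids permutations and orbits, and makes the next lemma a statement
  about arbitrary relations.
\<close>

definition cycles_of :: "('x \<times> 'x) set \<Rightarrow> 'x set set" where
  "cycles_of r = (\<lambda>y. r\<^sup>+ `` {y}) ` {y. (y, y) \<in> r\<^sup>+}"

text \<open>
  Removing a point \<open>x\<close> without a loop, and joining its predecessors to its successors, does not
  change which of the other points are reachable from which. So every cycle just loses the point
  \<open>x\<close>, if it contained it, and keeps at least one other point, by which it is still recognised.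
\<close>

lemma card_cycles_of_bypass:
  assumes irr: "(x, x) \<notin> r"
    and s: "s = {(a, b). a \<noteq> x \<and> b \<noteq> x \<and> ((a, b) \<in> r \<or> (a, x) \<in> r \<and> (x, b) \<in> r)}"
  shows "card (cycles_of s) = card (cycles_of r)"
proof -
  have s_r: "(a, b) \<in> r\<^sup>+ \<and> a \<noteq> x \<and> b \<noteq> x" if "(a, b) \<in> s\<^sup>+" for a b
    using that by (induction rule: trancl_induct) (auto simp: s intro: trancl_into_trancl)
  \<comment> \<open>a path that stops at the missing point is recorded by its last point before it\<close>
  have r_s: "(if b = x then \<exists>c. (c, x) \<in> r \<and> c \<noteq> x \<and> (a, c) \<in> s\<^sup>* else (a, b) \<in> s\<^sup>+)"
    if "(a, b) \<in> r\<^sup>+" "a \<noteq> x" for a b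
    using that
  proof (induction rule: trancl_induct)
    case (base b)
    then show ?case by (auto simp: s)
  next
    case (step b c)
    show ?case
    proof (cases "b = x")
      case True
      then obtain e where e: "(e, x) \<in> r" "e \<noteq> x" "(a, e) \<in> s\<^sup>*"
        using step by auto
      moreover have "c \<noteq> x"
        using True step.hyps irr by auto
      ultimately have "(e, c) \<in> s"
        using True step.hyps by (auto simp: s)
      then show ?thesis
        using e \<open>c \<noteq> x\<close> by simp
    next
      case False
      then have ab: "(a, b) \<in> s\<^sup>+"
        using step by auto
      show ?thesis
      proof (cases "c = x")
        case True
        then show ?thesis using ab False step.hyps by (auto intro: trancl_into_rtrancl)
      next
        case c: False
        then have "(b, c) \<in> s" using False step.hyps by (auto simp: s)
        then show ?thesis using ab c by (auto intro: trancl_into_trancl)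
      qed
    qed
  qed
  have iff: "(a, b) \<in> s\<^sup>+ \<longleftrightarrow> (a, b) \<in> r\<^sup>+ \<and> a \<noteq> x \<and> b \<noteq> x" for a b
    using s_r r_s by metis
  have classes: "s\<^sup>+ `` {y} = r\<^sup>+ `` {y} - {x}" if "y \<noteq> x" for y
    using that by (auto simp: iff)
  let ?P = "{y. y \<noteq> x \<and> (y, y) \<in> r\<^sup>+}"
  have s_cyc: "cycles_of s = (\<lambda>C. C - {x}) ` (\<lambda>y. r\<^sup>+ `` {y}) ` ?P"
    unfolding cycles_of_def image_image by (intro image_cong) (auto simp: iff)
  \<comment> \<open>a cycle through the missing point is also the cycle of the successor\<close>
  have "r\<^sup>+ `` {x} \<in> (\<lambda>y. r\<^sup>+ `` {y}) ` ?P" if xx: "(x, x) \<in> r\<^sup>+"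
  proof -
    obtain c where c: "(x, c) \<in> r" "(c, x) \<in> r\<^sup>*"
      using tranclD[OF xx] by blast
    then have "c \<noteq> x" using irr by auto
    then have cx: "(c, x) \<in> r\<^sup>+" using c by (auto simp: rtrancl_eq_or_trancl)
    then have "r\<^sup>+ `` {x} = r\<^sup>+ `` {c}" "(c, c) \<in> r\<^sup>+"
      using c by (auto intro: trancl_trans)
    then show ?thesis using \<open>c \<noteq> x\<close> by blast
  qed
  then have r_cyc: "cycles_of r = (\<lambda>y. r\<^sup>+ `` {y}) ` ?P"
    unfolding cycles_of_def by blast
  have "inj_on (\<lambda>C. C - {x}) ((\<lambda>y. r\<^sup>+ `` {y}) ` ?P)"
  proof (rule inj_onI, elim imageE, clarify)
    fix y z assume *: "r\<^sup>+ `` {y} - {x} = r\<^sup>+ `` {z} - {x}" "y \<noteq> x" "z \<noteq> x" "(y, y) \<in> r\<^sup>+" "(z, z) \<in> r\<^sup>+"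
    then have "(z, y) \<in> r\<^sup>+" "(y, z) \<in> r\<^sup>+" by blast+
    then show "r\<^sup>+ `` {y} = r\<^sup>+ `` {z}" by (auto intro: trancl_trans)
  qed
  then show ?thesis
    unfolding s_cyc r_cyc by (rule card_image)
qed

text \<open>
  The points on cycles are those that can be reached from themselves: inside the core the orbits of
  the permutation are the sets of reachable points, and conversely the points that are mutually
  reachable with a given point of a cycle form a set that is permuted, hence lies in the core.
\<close>

lemma num_cycles_eq_card_cycles_of:
  assumes X: "finite X" and \<psi>: "\<psi> \<in> partial_perms X"
  shows "num_cycles \<psi> = card (cycles_of (Map.graph \<psi>))"
proof -
  let ?r = "Map.graph \<psi>"
  define p where "p = perm_restrict (the \<circ> \<psi>) (perm_core \<psi>)"
  note core = perm_core_bij_betw[OF \<psi>]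
  have fin: "finite (dom \<psi>)"
    using \<psi> X by (auto simp: partial_perms_def intro: finite_subset)
  have step: "(y, z) \<in> ?r \<longleftrightarrow> z = p y" "p y \<in> perm_core \<psi>" if "y \<in> perm_core \<psi>" for y z
    using that core by (auto simp: Map.graph_def perm_restrict_def p_def bij_betw_def)
  have "p permutes perm_core \<psi>"
  proof (rule bij_imp_permutes)
    show "bij_betw p (perm_core \<psi>) (perm_core \<psi>)"
      using core(2) by (rule bij_betw_cong[THEN iffD1, rotated]) (simp add: perm_restrict_def p_def)
  qed (simp add: perm_restrict_def p_def)
  then have perm: "permutation p"
    using core(1) fin by (auto simp: permutation_permutes intro: finite_subset)
  have orb: "orbit p y = ?r\<^sup>+ `` {y}" if y: "y \<in> perm_core \<psi>" for y
  proof (intro set_eqI iffI)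
    fix z assume "z \<in> orbit p y"
    then have "(y, z) \<in> ?r\<^sup>+ \<and> z \<in> perm_core \<psi>"
      by induction (use y step in \<open>auto intro: trancl_into_trancl\<close>)
    then show "z \<in> ?r\<^sup>+ `` {y}" by simp
  next
    fix z assume "z \<in> ?r\<^sup>+ `` {y}"
    then have "(y, z) \<in> ?r\<^sup>+" by simp
    then have "z \<in> orbit p y \<and> z \<in> perm_core \<psi>"
      by (induction rule: trancl_induct) (use y step in \<open>auto intro: orbit.intros\<close>)
    then show "z \<in> orbit p y" by simp
  qed
  have "perm_core \<psi> = {y. (y, y) \<in> ?r\<^sup>+}"
  proof (intro set_eqI iffI CollectI)
    fix y assume "y \<in> perm_core \<psi>"
    then show "(y, y) \<in> ?r\<^sup>+"
      using orb permutation_self_in_orbit[OF perm, of y] by auto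
  next
    fix y assume "y \<in> {y. (y, y) \<in> ?r\<^sup>+}"
    then have y: "(y, y) \<in> ?r\<^sup>+" by simp
    \<comment> \<open>mutual reachability makes this set closed under images and under preimages\<close>
    define S where "S = {z. (y, z) \<in> ?r\<^sup>+ \<and> (z, y) \<in> ?r\<^sup>+}"
    have "S \<subseteq> dom \<psi>"
      by (auto simp: S_def Map.graph_def dest!: tranclD[of z y for z])
    moreover have "(the \<circ> \<psi>) ` S = S"
    proof (intro equalityI subsetI)
      fix z assume "z \<in> (the \<circ> \<psi>) ` S"
      then obtain u where u: "u \<in> S" "z = the (\<psi> u)" by auto
      then obtain w where "(u, w) \<in> ?r" "(w, y) \<in> ?r\<^sup>*"
        by (auto simp: S_def dest: tranclD)
      moreover from this have "w = z" using u by (simp add: Map.graph_def)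
      ultimately show "z \<in> S"
        using u(1) y by (auto simp: S_def rtrancl_eq_or_trancl intro: trancl_into_trancl)
    next
      fix z assume z: "z \<in> S"
      then obtain u where u: "(y, u) \<in> ?r\<^sup>*" "(u, z) \<in> ?r"
        by (auto simp: S_def dest: tranclD2)
      then have "u \<in> S"
        using z y by (auto simp: S_def rtrancl_eq_or_trancl intro: trancl_into_trancl2)
      moreover have "z = (the \<circ> \<psi>) u" using u by (simp add: Map.graph_def)
      ultimately show "z \<in> (the \<circ> \<psi>) ` S" by blast
    qed
    moreover have "inj_on (the \<circ> \<psi>) S"
    proof (rule inj_on_subset)
      show "inj_on (the \<circ> \<psi>) (dom \<psi>)"
        using \<psi> by (auto simp: partial_perms_def inj_on_def dom_def)
    qed fact
    ultimately show "y \<in> perm_core \<psi>"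
      using y unfolding perm_core_def bij_betw_def S_def by blast
  qed
  then show ?thesis
    unfolding num_cycles_def cycles_of_def p_def[symmetric] using orb
    by (metis (mono_tags, lifting) image_cong)
qed

section \<open>Links of a partial permutation\<close>

text \<open>
  A partial permutation consists of cycles and chains. Its links are its arrows, a link from outside
  (\<^const>\<open>None\<close>) to the first point of each chain, and a link from the last point of each chain to
  the outside. With the weights below the partial permanent becomes a sum of products over links,
  and the three kinds of factors \<open>M\<close>, \<open>\<theta>\<close>, \<open>\<phi>\<close> can be treated alike. The pair
  \<^term>\<open>(None, None)\<close> is never a link, and its weight \<open>1\<close> is a default value; below the pair marks the
  insertion of a new chain.
\<close>

definition links :: "'x set \<Rightarrow> ('x \<rightharpoonup> 'x) \<Rightarrow> ('x option \<times> 'x option) set" where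
  "links X \<psi> = (\<lambda>u. (Some u, \<psi> u)) ` dom \<psi> \<union> (\<lambda>v. (None, Some v)) ` (X - ran \<psi>)
     \<union> (\<lambda>u. (Some u, None)) ` (X - dom \<psi>)"

fun link_weight ::
    "('x \<Rightarrow> 'b::comm_ring_1) \<Rightarrow> ('x \<Rightarrow> 'b) \<Rightarrow> ('x \<Rightarrow> 'x \<Rightarrow> 'b) \<Rightarrow> 'x option \<times> 'x option \<Rightarrow> 'b" where
  "link_weight \<theta> \<phi> M (Some u, Some v) = M u v"
| "link_weight \<theta> \<phi> M (None, Some v) = \<theta> v"
| "link_weight \<theta> \<phi> M (Some u, None) = \<phi> u"
| "link_weight \<theta> \<phi> M (None, None) = 1"

lemma finite_partial_perms:
  assumes "finite X"
  shows "finite (partial_perms X)"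
proof (rule finite_subset)
  show "partial_perms X \<subseteq> (\<Union>D\<in>Pow X. {\<psi>. dom \<psi> = D \<and> ran \<psi> \<subseteq> X})"
    by (auto simp: partial_perms_def)
  show "finite (\<Union>D\<in>Pow X. {\<psi>. dom \<psi> = D \<and> ran \<psi> \<subseteq> X})"
    using assms by (intro finite_UN_I finite_set_of_finite_maps) (auto intro: finite_subset)
qed

lemma finite_links:
  assumes "finite X" "\<psi> \<in> partial_perms X"
  shows "finite (links X \<psi>)"
proof -
  have "finite (dom \<psi>)"
    using assms by (auto simp: partial_perms_def intro: finite_subset)
  then show ?thesis
    using assms(1) by (simp add: links_def)
qed

lemma None_None_notin_links [simp]: "(None, None) \<notin> links X \<psi>"
  by (auto simp: links_def)

lemma prod_links:
  assumes "finite X" "\<psi> \<in> partial_perms X"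
  shows "(\<Prod>e\<in>links X \<psi>. link_weight \<theta> \<phi> M e) =
    (\<Prod>x\<in>dom \<psi>. M x (the (\<psi> x))) * (\<Prod>y\<in>X - ran \<psi>. \<theta> y) * (\<Prod>z\<in>X - dom \<psi>. \<phi> z)"
proof -
  have fin: "finite (dom \<psi>)"
    using assms by (auto simp: partial_perms_def intro: finite_subset)
  have 1: "(\<Prod>e\<in>(\<lambda>u. (Some u, \<psi> u)) ` dom \<psi>. link_weight \<theta> \<phi> M e) = (\<Prod>x\<in>dom \<psi>. M x (the (\<psi> x)))"
    by (subst prod.reindex) (auto simp: inj_on_def intro!: prod.cong)
  have 2: "(\<Prod>e\<in>(\<lambda>v. (None, Some v)) ` (X - ran \<psi>). link_weight \<theta> \<phi> M e) = (\<Prod>y\<in>X - ran \<psi>. \<theta> y)"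
    by (subst prod.reindex) (auto simp: inj_on_def)
  have 3: "(\<Prod>e\<in>(\<lambda>u. (Some u, None)) ` (X - dom \<psi>). link_weight \<theta> \<phi> M e) = (\<Prod>z\<in>X - dom \<psi>. \<phi> z)"
    by (subst prod.reindex) (auto simp: inj_on_def)
  have disj: "(\<lambda>u. (Some u, \<psi> u)) ` dom \<psi> \<inter> (\<lambda>v. (None, Some v)) ` (X - ran \<psi>) = {}"
    "((\<lambda>u. (Some u, \<psi> u)) ` dom \<psi> \<union> (\<lambda>v. (None, Some v)) ` (X - ran \<psi>)) \<inter>
      (\<lambda>u. (Some u, None)) ` (X - dom \<psi>) = {}"
    by auto
  show ?thesis
    unfolding links_def using assms(1) fin
    by (simp only: prod.union_disjoint[OF _ _ disj(1)] prod.union_disjoint[OF _ _ disj(2)]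
        finite_imageI finite_Diff finite_UnI 1 2 3)
qed

section \<open>Inserting a point\<close>

text \<open>
  Inserting the new point \<open>x\<close> into the link \<open>e = (u, v)\<close> replaces it by the two links \<open>(u, x)\<close> and
  \<open>(x, v)\<close>. For \<open>e = (None, None)\<close> the point \<open>x\<close> becomes a chain of its own.
\<close>

definition insert_at :: "'x \<Rightarrow> 'x option \<times> 'x option \<Rightarrow> ('x \<rightharpoonup> 'x) \<Rightarrow> ('x \<rightharpoonup> 'x)" where
  "insert_at x e \<psi> = (\<lambda>y. if y = x then snd e else if fst e = Some y then Some x else \<psi> y)"

definition bypass :: "'x \<Rightarrow> ('x \<rightharpoonup> 'x) \<Rightarrow> ('x \<rightharpoonup> 'x)" where
  "bypass x \<psi> = (\<lambda>y. if y = x then None else if \<psi> y = Some x then \<psi> x else \<psi> y)"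

definition pred_of :: "'x \<Rightarrow> ('x \<rightharpoonup> 'x) \<Rightarrow> 'x option" where
  "pred_of x \<psi> = (if x \<in> ran \<psi> then Some (THE u. \<psi> u = Some x) else None)"

lemma pred_of_eq_Some_iff:
  assumes "inj_on \<psi> (dom \<psi>)"
  shows "pred_of x \<psi> = Some u \<longleftrightarrow> \<psi> u = Some x"
proof -
  have uniq: "u = v" if "\<psi> u = Some x" "\<psi> v = Some x" for u v
    using assms that by (auto simp: inj_on_def dom_def)
  then have "(THE u. \<psi> u = Some x) = u" if "\<psi> u = Some x" for u
    using that by (intro the_equality) auto
  then show ?thesis
    by (auto simp: pred_of_def ran_def)
qed

lemma partial_permsI:
  assumes "\<And>u v. \<psi> u = Some v \<Longrightarrow> u \<in> X \<and> v \<in> X"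
    and "\<And>u u' v. \<psi> u = Some v \<Longrightarrow> \<psi> u' = Some v \<Longrightarrow> u = u'"
  shows "\<psi> \<in> partial_perms X"
proof -
  have "dom \<psi> \<subseteq> X" "ran \<psi> \<subseteq> X"
    using assms(1) by (auto simp: ran_def)
  moreover have "inj_on \<psi> (dom \<psi>)"
    using assms(2) by (metis domD inj_onI)
  ultimately show ?thesis by (simp add: partial_perms_def)
qed

lemma partial_permsD:
  assumes "\<psi> \<in> partial_perms X"
  shows "\<psi> u = Some v \<Longrightarrow> u \<in> X \<and> v \<in> X"
    and "\<psi> u = Some v \<Longrightarrow> \<psi> u' = Some v \<Longrightarrow> u = u'"
proof -
  show "u \<in> X \<and> v \<in> X" if "\<psi> u = Some v"
    using assms that by (auto simp: partial_perms_def ran_def)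
  show "u = u'" if "\<psi> u = Some v" "\<psi> u' = Some v"
    using assms that unfolding partial_perms_def by (auto dest: inj_onD[of \<psi> _ u u'])
qed

lemma links_Some:
  "\<psi> \<in> partial_perms X \<Longrightarrow> (Some u, h) \<in> links X \<psi> \<longleftrightarrow> u \<in> X \<and> \<psi> u = h"
  by (cases h) (auto simp: links_def partial_perms_def image_iff)

lemma links_None: "(None, h) \<in> links X \<psi> \<longleftrightarrow> (\<exists>v\<in>X - ran \<psi>. h = Some v)"
  by (auto simp: links_def)

text \<open>
  This is what the insertion into \<open>(e, f)\<close> requires of the pair; it holds equally for a link
  and for the dummy \<^term>\<open>(None, None)\<close>.
\<close>

lemma link_facts:
  assumes \<psi>: "\<psi> \<in> partial_perms X" and ef: "(e, f) \<in> insert (None, None) (links X \<psi>)"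
  shows "e = Some u \<Longrightarrow> u \<in> X" "f = Some v \<Longrightarrow> v \<in> X"
    and "e = Some u \<Longrightarrow> \<psi> u = f"
    and "f = Some v \<Longrightarrow> \<psi> u = Some v \<Longrightarrow> e = Some u"
proof -
  show "u \<in> X" "\<psi> u = f" if "e = Some u"
    using ef that by (auto simp: links_Some[OF \<psi>])
  show "v \<in> X" if "f = Some v"
    using ef that partial_permsD(1)[OF \<psi>, of _ v] by (cases e) (auto simp: links_Some[OF \<psi>] links_None)
  show "e = Some u" if "f = Some v" "\<psi> u = Some v"
  proof (cases e)
    case None
    then show ?thesis using ef that by (auto simp: links_None ran_def)
  next
    case (Some u')
    then have "\<psi> u' = Some v" using ef that by (simp add: links_Some[OF \<psi>])
    then show ?thesis using that(2) Some partial_permsD(2)[OF \<psi>] by metis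
  qed
qed

lemma fresh_partial_perms:
  assumes "\<psi> \<in> partial_perms X" "x \<notin> X"
  shows "\<psi> u \<noteq> Some x" "\<psi> x = None"
  using assms by (auto simp: partial_perms_def ran_def)

lemma insert_at_partial_perms:
  assumes "\<psi> \<in> partial_perms X" "x \<notin> X" "(e, f) \<in> insert (None, None) (links X \<psi>)"
  shows "insert_at x (e, f) \<psi> \<in> partial_perms (insert x X)"
proof (rule partial_permsI)
  note D = partial_permsD[OF assms(1)] and L = link_facts[OF assms(1,3)]
  note nx = fresh_partial_perms[OF assms(1,2)]
  have f: "f \<noteq> Some x" using L(2)[of x] assms(2) by auto
  show "u \<in> insert x X \<and> v \<in> insert x X" if "insert_at x (e, f) \<psi> u = Some v" for u v
    using that D(1)[of u v] L(1)[of u] L(2)[of v]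
    by (auto simp: insert_at_def split: if_splits)
  have at: "u = x \<and> f = Some v \<or> u \<noteq> x \<and> e = Some u \<and> v = x \<or> u \<noteq> x \<and> e \<noteq> Some u \<and> \<psi> u = Some v"
    if "insert_at x (e, f) \<psi> u = Some v" for u v
    using that by (auto simp: insert_at_def split: if_splits)
  show "u = u'" if "insert_at x (e, f) \<psi> u = Some v" "insert_at x (e, f) \<psi> u' = Some v" for u u' v
    using at[OF that(1)] at[OF that(2)] f nx(1) D(2) L(4) by (metis option.inject)
qed

lemma bypass_partial_perms:
  assumes "\<psi> \<in> partial_perms (insert x X)"
  shows "bypass x \<psi> \<in> partial_perms X"
proof (rule partial_permsI)
  note D = partial_permsD[OF assms]
  have at: "u \<noteq> x \<and> v \<noteq> x \<and> (\<psi> u = Some x \<and> \<psi> x = Some v \<or> \<psi> u = Some v)"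
    if "bypass x \<psi> u = Some v" for u v
    using that D(2)[of u x x] by (auto simp: bypass_def split: if_splits)
  show "u \<in> X \<and> v \<in> X" if "bypass x \<psi> u = Some v" for u v
    using at[OF that] D(1) by (metis insert_iff)
  show "u = u'" if "bypass x \<psi> u = Some v" "bypass x \<psi> u' = Some v" for u u' v
    using at[OF that(1)] at[OF that(2)] D(2) by metis
qed

text \<open>
  Subdividing a link leaves all other links in place. This single description covers the insertion
  into an arrow, before a chain, after a chain, and as a new chain.
\<close>

lemma links_insert_at:
  assumes \<psi>: "\<psi> \<in> partial_perms X" and x: "x \<notin> X"
    and ef: "(e, f) \<in> insert (None, None) (links X \<psi>)"
  shows "links (insert x X) (insert_at x (e, f) \<psi>) =
    insert (e, Some x) (insert (Some x, f) (links X \<psi> - {(e, f)}))"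
proof (intro set_eqI, unfold split_paired_all)
  fix g h
  note L = link_facts[OF \<psi> ef] and nx = fresh_partial_perms[OF \<psi> x]
  have f: "f \<noteq> Some x" and e: "e \<noteq> Some x"
    using L(1)[of x] L(2)[of x] x by auto
  show "(g, h) \<in> links (insert x X) (insert_at x (e, f) \<psi>) \<longleftrightarrow>
    (g, h) \<in> insert (e, Some x) (insert (Some x, f) (links X \<psi> - {(e, f)}))"
  proof (cases g)
    case g: None
    have ran_x: "x \<in> ran (insert_at x (e, f) \<psi>) \<longleftrightarrow> e \<noteq> None"
      using f e nx by (cases e) (auto simp: insert_at_def ran_def)
    have keep: "insert_at x (e, f) \<psi> u = Some v" if "\<psi> u = Some v" "f \<noteq> Some v" for u v
      using that nx(2) L(3)[of u] by (auto simp: insert_at_def)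
    have new: "insert_at x (e, f) \<psi> x = f"
      by (simp add: insert_at_def)
    have old: "f = Some v \<or> \<psi> u = Some v" if "insert_at x (e, f) \<psi> u = Some v" "v \<noteq> x" for u v
      using that by (auto simp: insert_at_def split: if_splits)
    have ran: "v \<in> ran (insert_at x (e, f) \<psi>) \<longleftrightarrow> f = Some v \<or> v \<in> ran \<psi>" if "v \<noteq> x" for v
      unfolding ran_def mem_Collect_eq using that keep new old by metis
    have f_ran: "e = None" if "f = Some v" "v \<notin> ran \<psi>" for v
      using that L(3) by (cases e) (auto simp: ran_def)
    show ?thesis
    proof (cases "h = Some x")
      case True
      then show ?thesis
        using g ran_x x by (auto simp: links_None)
    next
      case False
      have "(None, h) \<in> links (insert x X) (insert_at x (e, f) \<psi>) \<longleftrightarrow>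
          (\<exists>v\<in>X. h = Some v \<and> f \<noteq> Some v \<and> v \<notin> ran \<psi>)"
        using False x ran by (auto simp: links_None)
      also have "\<dots> \<longleftrightarrow> (None, h) \<in> links X \<psi> - {(e, f)}"
        using f_ran by (auto simp: links_None)
      finally show ?thesis
        using False g by simp
    qed
  next
    case g: (Some u)
    have "(Some u, h) \<in> links (insert x X) (insert_at x (e, f) \<psi>) \<longleftrightarrow>
        (u = x \<or> u \<in> X) \<and> insert_at x (e, f) \<psi> u = h"
      using links_Some[OF insert_at_partial_perms[OF \<psi> x ef]] by simp
    then show ?thesis
      using g e x L(1)[of u] L(3)[of u]
      by (cases "u = x"; cases "e = Some u") (auto simp: insert_at_def links_Some[OF \<psi>])
  qed
qed

lemma insert_at_bypass:
  assumes "\<psi> \<in> partial_perms (insert x X)" "\<psi> x \<noteq> Some x"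
  shows "insert_at x (pred_of x \<psi>, \<psi> x) (bypass x \<psi>) = \<psi>"
    and "(pred_of x \<psi>, \<psi> x) \<in> insert (None, None) (links X (bypass x \<psi>))"
proof -
  have inj: "inj_on \<psi> (dom \<psi>)" using assms by (simp add: partial_perms_def)
  note p = pred_of_eq_Some_iff[OF inj] and D = partial_permsD[OF assms(1)]
  show "insert_at x (pred_of x \<psi>, \<psi> x) (bypass x \<psi>) = \<psi>"
    by (auto simp: insert_at_def bypass_def p fun_eq_iff)
  show "(pred_of x \<psi>, \<psi> x) \<in> insert (None, None) (links X (bypass x \<psi>))"
  proof (cases "pred_of x \<psi>")
    case (Some u)
    then have "u \<in> insert x X" "u \<noteq> x" "bypass x \<psi> u = \<psi> x"
      using assms(2) D(1)[of u x] by (auto simp: bypass_def p)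
    then show ?thesis
      using Some by (simp add: links_Some[OF bypass_partial_perms[OF assms(1)]])
  next
    case None
    then have nx: "\<psi> u \<noteq> Some x" for u
      using p[of x u] by simp
    have "v \<in> X - ran (bypass x \<psi>)" if v: "\<psi> x = Some v" for v
    proof -
      have "bypass x \<psi> u \<noteq> Some v" for u
        using nx D(2)[OF v, of u] by (auto simp: bypass_def)
      moreover have "v \<in> X"
        using D(1)[OF v] v assms(2) by auto
      ultimately show ?thesis
        by (simp add: ran_def)
    qed
    then show ?thesis
      using None by (cases "\<psi> x") (auto simp: links_None)
  qed
qed

lemma bypass_insert_at:
  assumes "\<psi> \<in> partial_perms X" "x \<notin> X" "(e, f) \<in> insert (None, None) (links X \<psi>)"
  shows "bypass x (insert_at x (e, f) \<psi>) = \<psi>"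
    and "pred_of x (insert_at x (e, f) \<psi>) = e"
    and "insert_at x (e, f) \<psi> x = f" and "f \<noteq> Some x"
proof -
  note L = link_facts[OF assms(1,3)] and nx = fresh_partial_perms[OF assms(1,2)]
  have e: "e \<noteq> Some x" using L(1)[of x] assms(2) by auto
  show f: "f \<noteq> Some x" using L(2)[of x] assms(2) by auto
  show "bypass x (insert_at x (e, f) \<psi>) = \<psi>"
    using L(3) nx f by (auto simp: bypass_def insert_at_def fun_eq_iff)
  have inj: "inj_on (insert_at x (e, f) \<psi>) (dom (insert_at x (e, f) \<psi>))"
    using insert_at_partial_perms[OF assms] by (simp add: partial_perms_def)
  have "pred_of x (insert_at x (e, f) \<psi>) = Some u \<longleftrightarrow> e = Some u" for u
    unfolding pred_of_eq_Some_iff[OF inj] using e f nx by (auto simp: insert_at_def)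
  then show "pred_of x (insert_at x (e, f) \<psi>) = e"
    by (metis not_None_eq)
  show "insert_at x (e, f) \<psi> x = f" by (simp add: insert_at_def)
qed

text \<open>
  \<^const>\<open>bypass\<close> acts on the graph in the way described in \<open>card_cycles_of_bypass\<close>.
\<close>

lemma num_cycles_bypass:
  assumes "finite X" "\<psi> \<in> partial_perms (insert x X)" "\<psi> x \<noteq> Some x" 
  shows "num_cycles (bypass x \<psi>) = num_cycles \<psi>"
proof -
  have "Map.graph (bypass x \<psi>) = {(a, b). a \<noteq> x \<and> b \<noteq> x \<and>
     ((a, b) \<in> Map.graph \<psi> \<or> (a, x) \<in> Map.graph \<psi> \<and> (x, b) \<in> Map.graph \<psi>)}"
    using assms(3) by (auto simp: bypass_def Map.graph_def split: if_splits)
  then show ?thesis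
    using assms bypass_partial_perms[OF assms(2)]
    by (simp add: num_cycles_eq_card_cycles_of[of "insert x X"]
          num_cycles_eq_card_cycles_of[of X]
        card_cycles_of_bypass[of x "Map.graph \<psi>"] Map.graph_def)
qed

lemma fixed_point_partial_perms:
  assumes "\<psi> \<in> partial_perms X" "x \<notin> X"
  shows "\<psi>(x \<mapsto> x) \<in> partial_perms (insert x X)"
proof (rule partial_permsI)
  note D = partial_permsD[OF assms(1)] and nx = fresh_partial_perms[OF assms]
  show "u \<in> insert x X \<and> v \<in> insert x X" if "(\<psi>(x \<mapsto> x)) u = Some v" for u v
    using that D(1)[of u v] by (auto split: if_splits)
  show "u = u'" if "(\<psi>(x \<mapsto> x)) u = Some v" "(\<psi>(x \<mapsto> x)) u' = Some v" for u u' v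
    using that nx D(2)[of u v u'] by (auto split: if_splits)
qed

lemma num_cycles_fixed_point:
  assumes "finite X" "\<psi> \<in> partial_perms X" "x \<notin> X"
  shows "num_cycles (\<psi>(x \<mapsto> x)) = Suc (num_cycles \<psi>)"
proof -
  let ?r = "Map.graph \<psi>" and ?r' = "Map.graph (\<psi>(x \<mapsto> x))"
  note nx = fresh_partial_perms[OF assms(2,3)]
  have r': "?r' = insert (x, x) ?r"
    using nx by (auto simp: Map.graph_def split: if_splits)
  have xr: "(x, y) \<notin> ?r\<^sup>+" "(y, x) \<notin> ?r\<^sup>+" for y
    using nx by (auto simp: Map.graph_def dest: tranclD tranclD2)
  then have tr: "?r'\<^sup>+ = insert (x, x) (?r\<^sup>+)"
    unfolding r' trancl_insert by (auto simp: rtrancl_eq_or_trancl)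
  have "{y. (y, y) \<in> insert (x, x) (?r\<^sup>+)} = insert x {y. (y, y) \<in> ?r\<^sup>+}"
    and "insert (x, x) (?r\<^sup>+) `` {x} = {x}"
    using xr by auto
  moreover have "insert (x, x) (?r\<^sup>+) `` {y} = ?r\<^sup>+ `` {y}" if "(y, y) \<in> ?r\<^sup>+" for y
    using xr that by auto
  ultimately have "cycles_of ?r' = insert {x} (cycles_of ?r)"
    unfolding cycles_of_def tr by simp
  moreover have "{x} \<notin> cycles_of ?r"
    using xr by (auto simp: cycles_of_def)
  moreover have "finite (cycles_of ?r)"
  proof -
    have "finite (Map.graph \<psi>)"
      using assms by (auto simp: partial_perms_def intro: finite_subset)
    then have "finite (Domain (?r\<^sup>+))"
      by (auto simp: finite_Domain)
    moreover have "cycles_of ?r \<subseteq> (\<lambda>y. ?r\<^sup>+ `` {y}) ` Domain (?r\<^sup>+)"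
      by (auto simp: cycles_of_def simp del: trancl_domain)
    ultimately show ?thesis by (meson finite_imageI finite_subset)
  qed
  moreover have "\<psi>(x \<mapsto> x) \<in> partial_perms (insert x X)"
    using assms by (intro fixed_point_partial_perms)
  ultimately show ?thesis
    using assms by (simp del: Map.graph_map_upd add: num_cycles_eq_card_cycles_of[of "insert x X"]
          num_cycles_eq_card_cycles_of[of X])
qed


section \<open>The recursion for the partial permanent\<close>

lemma pperm_eq_sum_links:
  assumes "finite X"
  shows "pperm \<beta> \<theta> \<phi> X M =
    (\<Sum>\<psi>\<in>partial_perms X. \<beta> ^ num_cycles \<psi> * (\<Prod>e\<in>links X \<psi>. link_weight \<theta> \<phi> M e))"
  unfolding pperm_def by (intro sum.cong refl) (simp only: prod_links[OF assms] mult.assoc)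

lemma links_fixed_point:
  assumes "\<psi> \<in> partial_perms X" "x \<notin> X"
  shows "links (insert x X) (\<psi>(x \<mapsto> x)) = insert (Some x, Some x) (links X \<psi>)"
proof (intro set_eqI, unfold split_paired_all)
  fix g h
  have "ran (\<psi>(x \<mapsto> x)) = insert x (ran \<psi>)"
    using fresh_partial_perms(2)[OF assms] by simp
  then show "(g, h) \<in> links (insert x X) (\<psi>(x \<mapsto> x)) \<longleftrightarrow> (g, h) \<in> insert (Some x, Some x) (links X \<psi>)"
    using assms(2)
    by (cases g) (auto simp: links_None links_Some[OF assms(1)] links_Some[OF fixed_point_partial_perms[OF assms]])
qed

lemma link_of_fresh:
  assumes "\<psi> \<in> partial_perms X" "x \<notin> X"
  shows "(e, Some x) \<notin> links X \<psi>" "(Some x, f) \<notin> links X \<psi>"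
  using fresh_partial_perms[OF assms] assms
  by (auto simp: links_Some[OF assms(1)], cases e) (auto simp: links_Some[OF assms(1)] links_None)

text \<open>
  Every partial permutation of \<^term>\<open>insert x X\<close> either fixes \<open>x\<close> or arises by exactly one insertion
  of \<open>x\<close> into a partial permutation of \<open>X\<close>, which is recovered by bypassing \<open>x\<close>; the place of the
  insertion is the pair of the predecessor and the successor of \<open>x\<close>.
\<close>

lemma sum_insert_at:
  fixes T :: "('x \<rightharpoonup> 'x) \<Rightarrow> 'b::comm_monoid_add"
  assumes "finite X" "x \<notin> X"
  shows "sum T (partial_perms (insert x X)) =
    (\<Sum>\<psi>\<in>partial_perms X. T (\<psi>(x \<mapsto> x)) + (\<Sum>e\<in>insert (None, None) (links X \<psi>). T (insert_at x e \<psi>)))"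
proof -
  let ?P = "partial_perms (insert x X)" and ?S = "\<lambda>\<psi>. insert (None, None) (links X \<psi>)"
  have fin: "finite (partial_perms X)" "finite ?P"
    using assms by (simp_all add: finite_partial_perms)
  have "sum T ?P = sum T {\<psi>\<in>?P. \<psi> x = Some x} + sum T {\<psi>\<in>?P. \<psi> x \<noteq> Some x}"
    using fin(2) by (subst sum.union_disjoint[symmetric]) (auto intro: sum.cong)
  also have "sum T {\<psi>\<in>?P. \<psi> x = Some x} = (\<Sum>\<psi>\<in>partial_perms X. T (\<psi>(x \<mapsto> x)))"
  proof (rule sum.reindex_bij_witness[where i = "\<lambda>\<psi>. \<psi>(x \<mapsto> x)" and j = "\<lambda>\<psi>. \<psi>(x := None)"])
    fix \<psi> assume \<psi>: "\<psi> \<in> {\<psi>\<in>?P. \<psi> x = Some x}"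
    then have "\<psi> \<in> ?P" by simp
    note D = partial_permsD[OF this]
    show "(\<psi>(x := None))(x \<mapsto> x) = \<psi>" using \<psi> by auto
    then show "T ((\<psi>(x := None))(x \<mapsto> x)) = T \<psi>" by simp
    show "\<psi>(x := None) \<in> partial_perms X"
    proof (rule partial_permsI)
      show "u \<in> X \<and> v \<in> X" if "(\<psi>(x := None)) u = Some v" for u v
      proof -
        have u: "u \<noteq> x" "\<psi> u = Some v" using that by (auto split: if_splits)
        then have "v \<noteq> x" using D(2)[of u x x] \<psi> by auto
        then show ?thesis using D(1)[OF u(2)] u(1) by simp
      qed
      show "u = u'" if "(\<psi>(x := None)) u = Some v" "(\<psi>(x := None)) u' = Some v" for u u' v
        using that D(2)[of u v u'] by (simp split: if_splits)
    qed
  next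
    fix \<psi> assume \<psi>: "\<psi> \<in> partial_perms X"
    show "(\<psi>(x \<mapsto> x))(x := None) = \<psi>"
      using fresh_partial_perms(2)[OF \<psi> assms(2)] by auto
    show "\<psi>(x \<mapsto> x) \<in> {\<psi>\<in>?P. \<psi> x = Some x}"
      using fixed_point_partial_perms[OF \<psi> assms(2)] by simp
  qed
  also have "sum T {\<psi>\<in>?P. \<psi> x \<noteq> Some x} = (\<Sum>(\<psi>, e)\<in>Sigma (partial_perms X) ?S. T (insert_at x e \<psi>))"
  proof (rule sum.reindex_bij_witness[where i = "\<lambda>(\<psi>, e). insert_at x e \<psi>"
        and j = "\<lambda>\<psi>. (bypass x \<psi>, (pred_of x \<psi>, \<psi> x))"])
    fix \<psi> assume "\<psi> \<in> {\<psi>\<in>?P. \<psi> x \<noteq> Some x}"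
    then have \<psi>: "\<psi> \<in> ?P" "\<psi> x \<noteq> Some x" by auto
    note * = insert_at_bypass[OF \<psi>]
    show "(case (bypass x \<psi>, pred_of x \<psi>, \<psi> x) of (\<psi>, e) \<Rightarrow> insert_at x e \<psi>) = \<psi>"
      by (simp add: *)
    show "(case (bypass x \<psi>, pred_of x \<psi>, \<psi> x) of (\<psi>, e) \<Rightarrow> T (insert_at x e \<psi>)) = T \<psi>"
      by (simp add: *)
    show "(bypass x \<psi>, pred_of x \<psi>, \<psi> x) \<in> Sigma (partial_perms X) ?S"
      using *(2) bypass_partial_perms[OF \<psi>(1)] by blast
  next
    fix y assume "y \<in> Sigma (partial_perms X) ?S"
    then obtain \<psi> e f where y: "y = (\<psi>, e, f)" and \<psi>: "\<psi> \<in> partial_perms X" and ef: "(e, f) \<in> ?S \<psi>"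
      by (cases y) auto
    note * = bypass_insert_at[OF \<psi> assms(2) ef] insert_at_partial_perms[OF \<psi> assms(2) ef]
    show "(bypass x (case y of (\<psi>, e) \<Rightarrow> insert_at x e \<psi>), pred_of x (case y of (\<psi>, e) \<Rightarrow> insert_at x e \<psi>),
        (case y of (\<psi>, e) \<Rightarrow> insert_at x e \<psi>) x) = y"
      by (simp add: y *)
    show "(case y of (\<psi>, e) \<Rightarrow> insert_at x e \<psi>) \<in> {\<psi>\<in>?P. \<psi> x \<noteq> Some x}"
      by (simp add: y *)
  qed
  also have "\<dots> = (\<Sum>\<psi>\<in>partial_perms X. \<Sum>e\<in>?S \<psi>. T (insert_at x e \<psi>))"
    using fin(1) finite_links[OF assms(1)] by (intro sum.Sigma[symmetric]) auto
  finally show ?thesis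
    by (simp only: sum.distrib)
qed

text \<open>
  The key recursion. The derivation replaces the weight of each link by the weight of the two links that
  subdivide it at \<open>x\<close>. Since the weight of a partial permutation is a product over links, the
  Leibniz rule yields the sum over all ways to insert \<open>x\<close> into one of them. The remaining partial
  permutations have \<open>x\<close> as a fixed point, with one more cycle, or as a chain of its own; they give
  the first summand.
\<close>

lemma (in derivation) pperm_insert:
  assumes "finite X" "x \<notin> X"
    and \<beta>: "d \<beta> = 0"
    and M: "\<And>u v. d (M u v) = M u x * M x v"
    and \<theta>: "\<And>v. d (\<theta> v) = \<theta> x * M x v"
    and \<phi>: "\<And>u. d (\<phi> u) = M u x * \<phi> x"
  shows "pperm \<beta> \<theta> \<phi> (insert x X) M =
    (\<beta> * M x x + \<theta> x * \<phi> x) * pperm \<beta> \<theta> \<phi> X M + d (pperm \<beta> \<theta> \<phi> X M)"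
proof -
  let ?w = "link_weight \<theta> \<phi> M"
  let ?T = "\<lambda>X \<psi>. \<beta> ^ num_cycles \<psi> * (\<Prod>e\<in>links X \<psi>. ?w e)"
  have dw: "d (?w (e, f)) = ?w (e, Some x) * ?w (Some x, f)" if "(e, f) \<noteq> (None, None)" for e f
    using that by (cases e; cases f) (simp_all add: M \<theta> \<phi>)
  have step: "?T (insert x X) (\<psi>(x \<mapsto> x))
        + (\<Sum>e\<in>insert (None, None) (links X \<psi>). ?T (insert x X) (insert_at x e \<psi>))
      = (\<beta> * M x x + \<theta> x * \<phi> x) * ?T X \<psi> + d (?T X \<psi>)"
    if \<psi>: "\<psi> \<in> partial_perms X" for \<psi>
  proof -
    let ?L = "links X \<psi>"
    note fin = finite_links[OF assms(1) \<psi>] and fresh = link_of_fresh[OF \<psi> assms(2)]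
    have 1: "?T (insert x X) (\<psi>(x \<mapsto> x)) = \<beta> * M x x * ?T X \<psi>"
      using num_cycles_fixed_point[OF assms(1) \<psi> assms(2)] fin fresh
      by (simp add: links_fixed_point[OF \<psi> assms(2)] mult_ac)
    have ins: "?T (insert x X) (insert_at x (e, f) \<psi>)
        = \<beta> ^ num_cycles \<psi> * (?w (e, Some x) * ?w (Some x, f) * prod ?w (?L - {(e, f)}))"
      if ef: "(e, f) \<in> insert (None, None) ?L" for e f
    proof -
      note undo = bypass_insert_at[OF \<psi> assms(2) ef]
      have "num_cycles (insert_at x (e, f) \<psi>) = num_cycles \<psi>"
        using num_cycles_bypass[OF assms(1) insert_at_partial_perms[OF \<psi> assms(2) ef]] undo by simp
      moreover have "(e, Some x) \<noteq> (Some x, f)"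
        using undo(4) by auto
      ultimately show ?thesis
        using fin fresh by (simp add: links_insert_at[OF \<psi> assms(2) ef] mult_ac)
    qed
    \<comment> \<open>the new chain: the dummy is not a link, so no factor is lost\<close>
    have 2: "?T (insert x X) (insert_at x (None, None) \<psi>) = \<theta> x * \<phi> x * ?T X \<psi>"
      by (subst ins) (simp_all add: mult_ac)
    have "(\<Sum>e\<in>?L. ?T (insert x X) (insert_at x e \<psi>)) =
        (\<Sum>e\<in>?L. \<beta> ^ num_cycles \<psi> * (d (?w e) * prod ?w (?L - {e})))"
    proof (intro sum.cong refl, unfold split_paired_all)
      fix e f assume ef: "(e, f) \<in> ?L"
      then have "(e, f) \<noteq> (None, None)" by (metis None_None_notin_links)
      then show "?T (insert x X) (insert_at x (e, f) \<psi>) =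
          \<beta> ^ num_cycles \<psi> * (d (?w (e, f)) * prod ?w (?L - {(e, f)}))"
        using ef by (subst ins) (simp_all only: dw[OF \<open>(e, f) \<noteq> (None, None)\<close>] insertI2)
    qed
    also have "\<dots> = d (?T X \<psi>)"
      by (simp add: mult power \<beta> prod[OF fin] sum_distrib_left)
    finally show ?thesis
      using 1 2 fin by (simp add: algebra_simps)
  qed
  have "finite (insert x X)" using assms(1) by simp
  then show ?thesis
    unfolding pperm_eq_sum_links[OF assms(1)] pperm_eq_sum_links[OF \<open>finite (insert x X)\<close>]
      sum_insert_at[OF assms(1,2)] sum sum_distrib_left sum.distrib[symmetric]
    by (intro sum.cong refl step)
qed

text \<open>
  Every point \<open>y\<close> has exactly one incoming link, which is either an arrow or contributes \<open>\<theta> y\<close>. So the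
  partial permanent is homogeneous of degree \<^term>\<open>card X\<close> if the entries of \<open>M\<close> and \<open>\<theta>\<close> have
  degree one and those of \<open>\<phi>\<close> have degree zero.
\<close>

lemma (in derivation) eigen_pperm:
  assumes X: "finite X"
    and \<beta>: "d \<beta> = 0"
    and M: "\<And>u v. d (M u v) = M u v"
    and \<theta>: "\<And>v. d (\<theta> v) = \<theta> v"
    and \<phi>: "\<And>u. d (\<phi> u) = 0"
  shows "d (pperm \<beta> \<theta> \<phi> X M) = of_nat (card X) * pperm \<beta> \<theta> \<phi> X M"
  unfolding pperm_def sum sum_distrib_left
proof (intro sum.cong refl)
  fix \<psi> assume "\<psi> \<in> partial_perms X"
  then have \<psi>: "dom \<psi> \<subseteq> X" "ran \<psi> \<subseteq> X" "inj_on \<psi> (dom \<psi>)"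
    by (auto simp: partial_perms_def)
  have "ran \<psi> = (the \<circ> \<psi>) ` dom \<psi>"
    by (force simp: ran_def dom_def)
  moreover have "inj_on (the \<circ> \<psi>) (dom \<psi>)"
    using \<psi>(3) by (auto simp: inj_on_def dom_def)
  ultimately have "card (ran \<psi>) = card (dom \<psi>)"
    by (simp only: card_image)
  then have card: "card (dom \<psi>) + card (X - ran \<psi>) = card X"
    using X \<psi>(2) card_mono[OF X \<psi>(2)] by (simp add: card_Diff_subset finite_subset)
  have 1: "d (\<beta> ^ num_cycles \<psi>) = of_nat 0 * \<beta> ^ num_cycles \<psi>"
    by (simp add: power \<beta>)
  have 2: "d (\<Prod>x\<in>dom \<psi>. M x (the (\<psi> x))) = of_nat (1 * card (dom \<psi>)) * (\<Prod>x\<in>dom \<psi>. M x (the (\<psi> x)))"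
    by (rule eigen_prod) (simp add: M)
  have 3: "d (\<Prod>y\<in>X - ran \<psi>. \<theta> y) = of_nat (1 * card (X - ran \<psi>)) * (\<Prod>y\<in>X - ran \<psi>. \<theta> y)"
    by (rule eigen_prod) (simp add: \<theta>)
  have 4: "d (\<Prod>z\<in>X - dom \<psi>. \<phi> z) = of_nat (0 * card (X - dom \<psi>)) * (\<Prod>z\<in>X - dom \<psi>. \<phi> z)"
    by (rule eigen_prod) (simp add: \<phi>)
  show "d (\<beta> ^ num_cycles \<psi> * (\<Prod>x\<in>dom \<psi>. M x (the (\<psi> x)))
      * (\<Prod>y\<in>X - ran \<psi>. \<theta> y) * (\<Prod>z\<in>X - dom \<psi>. \<phi> z))
    = of_nat (card X) * (\<beta> ^ num_cycles \<psi> * (\<Prod>x\<in>dom \<psi>. M x (the (\<psi> x)))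
      * (\<Prod>y\<in>X - ran \<psi>. \<theta> y) * (\<Prod>z\<in>X - dom \<psi>. \<phi> z))"
    using eigen_mult[OF eigen_mult[OF eigen_mult[OF 1 2] 3] 4] card by simp
qed

section \<open>Derivatives of matrix powers\<close>

lemma mat_pow_0: "mat_pow A 0 = mat 1"
  by (simp add: mat_pow_def)

lemma mat_pow_Suc: "mat_pow A (Suc k) = A ** mat_pow A k"
  by (simp add: mat_pow_def)

lemma mat_pow_1: "mat_pow A (Suc 0) = A"
  by (simp add: mat_pow_0 mat_pow_Suc)

lemma mat_pow_add: "mat_pow A (j + k) = mat_pow A j ** mat_pow A k"
  by (induction j) (simp_all add: mat_pow_0 mat_pow_Suc matrix_mul_assoc)

lemma matrix_mult_nth: "(A ** B) $ i $ j = (\<Sum>l\<in>UNIV. A $ i $ l * B $ l $ j)"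
  by (simp add: matrix_matrix_mult_def)

text \<open>
  This is used with \<open>s = 0\<close> for the Euler derivation, where \<open>d A = A\<close>, and with \<open>s = 1\<close> for the insertion
  derivation, where \<open>d A = A\<^sup>2\<close>.
\<close>

lemma (in derivation) mat_pow:
  assumes A: "\<And>i j. d (A $ i $ j) = mat_pow A (Suc s) $ i $ j"
  shows "d (mat_pow A k $ i $ j) = of_nat k * mat_pow A (k + s) $ i $ j"
proof (induction k arbitrary: i j)
  case 0
  show ?case by (simp add: mat_pow_0 mat_def)
next
  case (Suc k)
  have "d (mat_pow A (Suc k) $ i $ j) =
      (\<Sum>l\<in>UNIV. mat_pow A (Suc s) $ i $ l * mat_pow A k $ l $ j) +
      (\<Sum>l\<in>UNIV. A $ i $ l * (of_nat k * mat_pow A (k + s) $ l $ j))"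
    by (simp add: mat_pow_Suc[of A k] matrix_mult_nth sum mult A Suc sum.distrib)
  also have "(\<Sum>l\<in>UNIV. A $ i $ l * (of_nat k * mat_pow A (k + s) $ l $ j)) =
      of_nat k * mat_pow A (Suc (k + s)) $ i $ j"
    by (simp add: mat_pow_Suc[of A "k + s"] matrix_mult_nth sum_distrib_left mult_ac)
  also have "(\<Sum>l\<in>UNIV. mat_pow A (Suc s) $ i $ l * mat_pow A k $ l $ j) = mat_pow A (Suc s + k) $ i $ j"
    by (simp only: mat_pow_add[of A "Suc s" k] matrix_mult_nth)
  finally show ?case
    by (simp add: algebra_simps)
qed

lemma (in derivation) trace_mat_pow:
  assumes A: "\<And>i j. d (A $ i $ j) = mat_pow A (Suc s) $ i $ j"
  shows "d (trace (mat_pow A k)) = of_nat k * trace (mat_pow A (k + s))"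
  by (simp add: trace_def sum mat_pow[OF A] sum_distrib_left)

definition bilin :: "'a::comm_ring_1 ^ 'n \<Rightarrow> 'a ^ 'n ^ 'n \<Rightarrow> 'a ^ 'n \<Rightarrow> 'a" where
  "bilin \<theta> B \<phi> = (\<Sum>i\<in>UNIV. \<Sum>j\<in>UNIV. \<theta> $ i * B $ i $ j * \<phi> $ j)"

text \<open>
  With \<open>d \<theta> = \<theta> A\<^sup>s\<close> and \<open>d \<phi> = b A\<^sup>s \<phi>\<close>, the outer factors of \<open>\<theta> A\<^sup>k \<phi>\<close> contribute \<open>1\<close> and \<open>b\<close> copies
  of \<open>\<theta> A\<^bsup>k + s\<^esup> \<phi>\<close> to the \<open>k\<close> copies that come from the powers of the matrix.
\<close>

lemma (in derivation) bilin_mat_pow: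
  fixes A :: "'a ^ 'n ^ 'n"
  assumes A: "\<And>i j. d (A $ i $ j) = mat_pow A (Suc s) $ i $ j"
    and \<theta>: "\<And>j. d (\<theta> $ j) = (\<Sum>i\<in>UNIV. \<theta> $ i * mat_pow A s $ i $ j)"
    and \<phi>: "\<And>i. d (\<phi> $ i) = of_nat b * (\<Sum>j\<in>UNIV. mat_pow A s $ i $ j * \<phi> $ j)"
  shows "d (bilin \<theta> (mat_pow A k) \<phi>) = of_nat (k + 1 + b) * bilin \<theta> (mat_pow A (k + s)) \<phi>"
proof -
  let ?B = "mat_pow A k" and ?S = "mat_pow A s" and ?C = "bilin \<theta> (mat_pow A (k + s)) \<phi>"
  have "d (bilin \<theta> ?B \<phi>) = (\<Sum>i\<in>UNIV. \<Sum>j\<in>UNIV. d (\<theta> $ i) * ?B $ i $ j * \<phi> $ j)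
      + (\<Sum>i\<in>UNIV. \<Sum>j\<in>UNIV. \<theta> $ i * d (?B $ i $ j) * \<phi> $ j)
      + (\<Sum>i\<in>UNIV. \<Sum>j\<in>UNIV. \<theta> $ i * ?B $ i $ j * d (\<phi> $ j))"
    by (simp add: bilin_def sum mult distrib_right sum.distrib)
  also have "(\<Sum>i\<in>UNIV. \<Sum>j\<in>UNIV. d (\<theta> $ i) * ?B $ i $ j * \<phi> $ j) = ?C"
  proof -
    have "(\<Sum>i\<in>UNIV. \<Sum>j\<in>UNIV. d (\<theta> $ i) * ?B $ i $ j * \<phi> $ j)
        = (\<Sum>i\<in>UNIV. \<Sum>j\<in>UNIV. \<Sum>l\<in>UNIV. \<theta> $ l * ?S $ l $ i * ?B $ i $ j * \<phi> $ j)"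
      by (simp add: \<theta> sum_distrib_right)
    also have "\<dots> = (\<Sum>i\<in>UNIV. \<Sum>l\<in>UNIV. \<Sum>j\<in>UNIV. \<theta> $ l * ?S $ l $ i * ?B $ i $ j * \<phi> $ j)"
      by (intro sum.cong refl sum.swap)
    also have "\<dots> = (\<Sum>l\<in>UNIV. \<Sum>i\<in>UNIV. \<Sum>j\<in>UNIV. \<theta> $ l * ?S $ l $ i * ?B $ i $ j * \<phi> $ j)"
      by (rule sum.swap)
    also have "\<dots> = (\<Sum>l\<in>UNIV. \<Sum>j\<in>UNIV. \<Sum>i\<in>UNIV. \<theta> $ l * ?S $ l $ i * ?B $ i $ j * \<phi> $ j)"
      by (intro sum.cong refl sum.swap)
    also have "\<dots> = bilin \<theta> (?S ** ?B) \<phi>"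
      by (simp add: bilin_def matrix_mult_nth sum_distrib_left sum_distrib_right mult.assoc)
    finally show ?thesis
      by (simp only: mat_pow_add[symmetric] add.commute)
  qed
  also have "(\<Sum>i\<in>UNIV. \<Sum>j\<in>UNIV. \<theta> $ i * d (?B $ i $ j) * \<phi> $ j) = of_nat k * ?C"
    by (simp add: mat_pow[OF A] bilin_def sum_distrib_left mult_ac)
  also have "(\<Sum>i\<in>UNIV. \<Sum>j\<in>UNIV. \<theta> $ i * ?B $ i $ j * d (\<phi> $ j)) = of_nat b * ?C"
  proof -
    have "(\<Sum>i\<in>UNIV. \<Sum>j\<in>UNIV. \<theta> $ i * ?B $ i $ j * d (\<phi> $ j))
        = (\<Sum>i\<in>UNIV. \<Sum>j\<in>UNIV. \<Sum>l\<in>UNIV. of_nat b * (\<theta> $ i * ?B $ i $ j * ?S $ j $ l * \<phi> $ l))"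
      by (simp add: \<phi> sum_distrib_left mult_ac)
    also have "\<dots> = (\<Sum>i\<in>UNIV. \<Sum>l\<in>UNIV. \<Sum>j\<in>UNIV. of_nat b * (\<theta> $ i * ?B $ i $ j * ?S $ j $ l * \<phi> $ l))"
      by (intro sum.cong refl sum.swap)
    also have "\<dots> = of_nat b * bilin \<theta> (?B ** ?S) \<phi>"
      by (simp add: bilin_def matrix_mult_nth sum_distrib_left sum_distrib_right mult.assoc)
    finally show ?thesis
      by (simp only: mat_pow_add[symmetric])
  qed
  finally show ?thesis
    by (simp add: algebra_simps)
qed

section \<open>Exponentials and graded series\<close>

text \<open>
  The series without monomials of weight \<open>0\<close> form an ideal.
\<close>

lemma weight_zero_mult:
  assumes "\<And>m. weight w m = 0 \<Longrightarrow> mps_coeff f m = 0" "weight w m = 0"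
  shows "mps_coeff (f * g) m = 0"
  unfolding mps_coeff_mult
  using assms by (intro sum.neutral) (auto simp: splits_def weight_add)

lemma weight_zero_exp:
  fixes f :: "('v::finite, 'a::field_char_0) mps"
  assumes f: "\<And>m. weight w m = 0 \<Longrightarrow> mps_coeff f m = 0" and m: "weight w m = 0"
  shows "mps_coeff (mps_exp f) m = mps_coeff 1 m"
proof -
  let ?e = "\<lambda>k. mps_const (1 / fact k) * f ^ k"
  have "(?e has_sum mps_exp f) UNIV"
    unfolding mps_exp_def by (intro has_sum_infsum mps_exp_summable f) simp
  then obtain K where K: "finite K" "{0} \<subseteq> K" "mps_coeff (mps_exp f) m = (\<Sum>k\<in>K. mps_coeff (?e k) m)"
    by (rule has_sum_mps_coeffE[where J = "{0}" and m = m]) auto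
  have "mps_coeff (?e k) m = 0" if "k \<noteq> 0" for k
    using that weight_zero_mult[OF f m, of "f ^ (k - 1)"] by (cases k) auto
  then have "(\<Sum>k\<in>K. mps_coeff (?e k) m) = (\<Sum>k\<in>{0}. mps_coeff (?e k) m)"
    using K(1,2) by (intro sum.mono_neutral_right) auto
  then show ?thesis
    using K(3) by (simp add: mps_const_1)
qed

lemma has_sum_Suc_shift:
  fixes f :: "nat \<Rightarrow> 'a::topological_comm_monoid_add"
  assumes "((\<lambda>k. f (Suc k)) has_sum s) UNIV"
  shows "(f has_sum (f 0 + s)) UNIV"
proof -
  have "(f has_sum s) (range Suc)"
    using assms by (subst has_sum_reindex) (auto simp: o_def)
  then have "(f has_sum (f 0 + s)) (insert 0 (range Suc))"
    by (intro has_sum_insert) auto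
  then show ?thesis
    by (simp add: UNIV_nat_eq[symmetric])
qed

text \<open>
  If \<open>g k\<close> is homogeneous of weight \<open>k + 1\<close> and the derivation shifts the sequence with the factor
  \<open>k + 2\<close>, then Euler derivative and shifted series differ only in the initial term.
\<close>

lemma graded_series:
  fixes g :: "nat \<Rightarrow> ('v::finite, 'a::field_char_0) mps"
  assumes G: "(g has_sum G) UNIV"
    and E: "\<And>k. euler w (g k) = of_nat (Suc k) * g k"
    and D: "\<And>k. vector_field a (g k) = of_nat (Suc (Suc k)) * g (Suc k)"
  shows "euler w G = g 0 + vector_field a G"
    and "weight w m = 0 \<Longrightarrow> mps_coeff G m = 0"
proof -
  have "((\<lambda>k. euler w (g (Suc k))) has_sum vector_field a G) UNIV"
    using mps_derivation.has_sum[OF mps_derivation_vector_field G, of a] by (simp only: D E)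
  from has_sum_Suc_shift[OF this] have "((\<lambda>k. euler w (g k)) has_sum (g 0 + vector_field a G)) UNIV"
    by (simp add: E)
  with mps_derivation.has_sum[OF mps_derivation_euler G, of w]
  show "euler w G = g 0 + vector_field a G"
    by (rule has_sum_unique)
  show "mps_coeff G m = 0" if "weight w m = 0"
  proof -
    obtain K where "mps_coeff G m = (\<Sum>k\<in>K. mps_coeff (g k) m)"
      by (rule has_sum_mps_coeffE[OF G, of "{}" m]) auto
    then show ?thesis
      using euler_eigen_coeff[OF E] that by simp
  qed
qed

section \<open>The generating function of the partial permanents\<close>

instance indet :: (finite) finite
proof
  have "(UNIV :: 'a indet set) = insert Beta (range (case_prod Entry) \<union> range Theta \<union> range Phi)"
  proof (intro UNIV_eq_I)
    fix v :: "'a indet"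
    show "v \<in> insert Beta (range (case_prod Entry) \<union> range Theta \<union> range Phi)"
      by (cases v) auto
  qed
  then show "finite (UNIV :: 'a indet set)"
    by (metis finite_Un finite_imageI finite_insert finite)
qed

abbreviation indet_A :: "('n::finite indet, rat) mps ^ 'n ^ 'n" where
  "indet_A \<equiv> \<chi> i j. mps_indet (Entry i j)"

abbreviation indet_\<theta> :: "('n::finite indet, rat) mps ^ 'n" where
  "indet_\<theta> \<equiv> \<chi> i. mps_indet (Theta i)"

abbreviation indet_\<phi> :: "('n::finite indet, rat) mps ^ 'n" where
  "indet_\<phi> \<equiv> \<chi> i. mps_indet (Phi i)"

text \<open>
  The values on the indeterminates of the derivation that subdivides a link by a copy of \<open>i\<close>. They are
  those that \<open>pperm_insert\<close> asks for.
\<close>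

fun subdivide :: "'n::finite \<Rightarrow> 'n indet \<Rightarrow> ('n indet, rat) mps" where
  "subdivide i Beta = 0"
| "subdivide i (Entry u v) = mps_indet (Entry u i) * mps_indet (Entry i v)"
| "subdivide i (Theta v) = mps_indet (Theta i) * mps_indet (Entry i v)"
| "subdivide i (Phi u) = mps_indet (Entry u i) * mps_indet (Phi i)"

abbreviation subdivide_any :: "'n::finite indet \<Rightarrow> ('n indet, rat) mps" where
  "subdivide_any v \<equiv> \<Sum>i\<in>UNIV. subdivide i v"

text \<open>
  The weight of a link is the number of points it leads to, so that the weight of a monomial of
  a partial permanent is the number of points. Any point is the target of one link, hence
  \<^const>\<open>Theta\<close> counts and \<^const>\<open>Phi\<close> does not.
\<close>

fun num_points :: "'n indet \<Rightarrow> nat" where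
  "num_points (Entry u v) = 1"
| "num_points (Theta v) = 1"
| "num_points _ = 0"

text \<open>
  One more copy of the index \<open>i\<close> is one more point. The copies are numbered from \<open>1\<close>, so the new
  one has the label \<^term>\<open>Suc (r $ i)\<close>.
\<close>

lemma copies_Suc: "copies (r + axis i 1) = insert (i, Suc (r $ i)) (copies r)"
  by (auto simp: copies_def axis_def split: if_splits)

lemma finite_copies: "finite (copies r)"
  by (simp add: copies_def)

lemma card_copies: "card (copies r) = (\<Sum>i\<in>UNIV. r $ i)"
  by (simp add: copies_def)

abbreviation pperm_indet :: "nat ^ 'n::finite \<Rightarrow> ('n indet, rat) mps" where
  "pperm_indet \<equiv> pperm_copies (mps_indet Beta) indet_\<theta> indet_\<phi> indet_A"

lemma pperm_copies_Suc:
  "pperm_indet (r + axis i 1) =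
    (mps_indet Beta * mps_indet (Entry i i) + mps_indet (Theta i) * mps_indet (Phi i)) * pperm_indet r
      + vector_field (subdivide i) (pperm_indet r)"
proof -
  interpret mps_derivation "vector_field (subdivide i)"
    by (rule mps_derivation_vector_field)
  show ?thesis
    unfolding pperm_copies_def copies_Suc
    by (subst pperm_insert) (auto simp: finite_copies copies_def)
qed

lemma euler_pperm_copies:
  "euler num_points (pperm_indet r) = of_nat (\<Sum>i\<in>UNIV. r $ i) * pperm_indet r"
  for r :: "nat ^ 'n::finite"
proof -
  interpret mps_derivation "euler num_points :: ('n indet, rat) mps \<Rightarrow> _"
    by (rule mps_derivation_euler)
  show ?thesis
    unfolding pperm_copies_def card_copies[symmetric]
    by (rule eigen_pperm) (auto simp: finite_copies euler_indet)
qed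

lemma finite_multiplicities: "finite {r :: nat ^ 'n. (\<Sum>i\<in>UNIV. r $ i) = N}"
proof (rule finite_subset)
  show "{r :: nat ^ 'n. (\<Sum>i\<in>UNIV. r $ i) = N} \<subseteq> vec_lambda ` (PiE UNIV (\<lambda>_. {..N}))"
  proof
    fix r :: "nat ^ 'n" assume r: "r \<in> {r. (\<Sum>i\<in>UNIV. r $ i) = N}"
    have "r $ i \<le> N" for i
      using r member_le_sum[of i UNIV "\<lambda>i. r $ i"] by simp
    then have "(\<lambda>i. r $ i) \<in> PiE UNIV (\<lambda>_. {..N})" by auto
    then show "r \<in> vec_lambda ` (PiE UNIV (\<lambda>_. {..N}))"
      by (intro image_eqI[of _ _ "\<lambda>i. r $ i"]) (simp_all add: vec_eq_iff)
  qed
qed (intro finite_imageI finite_PiE; simp)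

definition pperm_summand :: "nat ^ 'n::finite \<Rightarrow> ('n indet, rat) mps" where
  "pperm_summand r = mps_const (1 / (\<Prod>i\<in>UNIV. fact (r $ i))) * pperm_indet r"

lemma euler_pperm_summand:
  "euler num_points (pperm_summand r) = of_nat (\<Sum>i\<in>UNIV. r $ i) * pperm_summand r"
  unfolding pperm_summand_def
  by (simp only: mps_derivation.const_mult[OF mps_derivation_euler] euler_pperm_copies mult.left_commute)

lemma prod_fact_Suc:
  "(\<Prod>j\<in>UNIV. fact ((r + axis i 1) $ j) :: rat) = of_nat (Suc (r $ i)) * (\<Prod>j\<in>UNIV. fact (r $ j))"
proof -
  have "(\<Prod>j\<in>UNIV. fact ((r + axis i 1) $ j) :: rat) =
      (\<Prod>j\<in>UNIV. (if j = i then of_nat (Suc (r $ i)) else 1) * fact (r $ j))"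
    by (rule prod.cong) (auto simp: axis_def)
  then show ?thesis
    by (simp add: prod.distrib del: of_nat_Suc)
qed

lemma pperm_summand_Suc:
  "of_nat (Suc (r $ i)) * pperm_summand (r + axis i 1) =
    (mps_indet Beta * mps_indet (Entry i i) + mps_indet (Theta i) * mps_indet (Phi i)) * pperm_summand r
      + vector_field (subdivide i) (pperm_summand r)"
proof -
  let ?c = "mps_const (1 / (\<Prod>i\<in>UNIV. fact (r $ i))) :: ('a indet, rat) mps"
  have "of_nat (Suc (r $ i)) * pperm_summand (r + axis i 1) = ?c * pperm_indet (r + axis i 1)"
    unfolding pperm_summand_def prod_fact_Suc mps_const_of_nat[symmetric] mult.assoc[symmetric] mps_const_mult
    by (simp del: of_nat_Suc)
  also have "\<dots> =
      (mps_indet Beta * mps_indet (Entry i i) + mps_indet (Theta i) * mps_indet (Phi i)) * (?c * pperm_indet r)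
      + ?c * vector_field (subdivide i) (pperm_indet r)"
    unfolding pperm_copies_Suc distrib_left by (simp only: mult.left_commute)
  finally show ?thesis
    by (simp only: pperm_summand_def mps_derivation.const_mult[OF mps_derivation_vector_field])
qed

lemma pperm_summand_has_sum: "\<exists>F. (pperm_summand has_sum F) UNIV"
proof -
  have "finite {r \<in> UNIV. mps_coeff (pperm_summand r) m \<noteq> 0}" for m
  proof (rule finite_subset)
    show "{r \<in> UNIV. mps_coeff (pperm_summand r) m \<noteq> 0} \<subseteq> {r. (\<Sum>i\<in>UNIV. r $ i) = weight num_points m}"
      using euler_eigen_coeff[OF euler_pperm_summand] by (metis (mono_tags, lifting) mem_Collect_eq subsetI)
  qed (rule finite_multiplicities)
  from has_sum_mps[OF this] show ?thesis by blast
qed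

definition single_point_weight :: "('n::finite indet, rat) mps" where
  "single_point_weight =
    (\<Sum>i\<in>UNIV. mps_indet Beta * mps_indet (Entry i i) + mps_indet (Theta i) * mps_indet (Phi i))"

lemma has_sum_sum_mps:
  fixes F :: "'i \<Rightarrow> 'r \<Rightarrow> ('v, 'a::comm_ring_1) mps"
  assumes "\<And>i. i \<in> I \<Longrightarrow> (F i has_sum S i) R"
  shows "((\<lambda>r. \<Sum>i\<in>I. F i r) has_sum (\<Sum>i\<in>I. S i)) R"
  using assms by (induction I rule: infinite_finite_induct) (auto intro: has_sum_add)

text \<open>
  For fixed \<open>i\<close> the recursion expresses \<^term>\<open>r $ i + 1\<close> times the term for \<^term>\<open>r + axis i 1\<close>
  through the term for \<open>r\<close>. Over all \<open>r\<close> the former are the terms multiplied by \<open>r $ i\<close>, except for those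
  with \<open>r $ i = 0\<close>, which vanish. Summing over \<open>i\<close> gives the Euler derivative, because the multiplicities
  add up to the number of points.
\<close>

lemma pperm_series_equation:
  assumes F: "(pperm_summand has_sum (F :: ('n::finite indet, rat) mps)) UNIV"
  shows "euler num_points F = single_point_weight * F + vector_field subdivide_any F"
proof -
  let ?c = "\<lambda>i. mps_indet Beta * mps_indet (Entry i i) + mps_indet (Theta i) * mps_indet (Phi i)
    :: ('n indet, rat) mps"
  have step: "((\<lambda>r. of_nat (r $ i) * pperm_summand r) has_sum
      (?c i * F + vector_field (subdivide i) F)) UNIV" for i
  proof -
    let ?h = "\<lambda>r :: nat ^ 'n. of_nat (r $ i) * pperm_summand r :: ('n indet, rat) mps"
    let ?s = "\<lambda>r :: nat ^ 'n. r + axis i 1"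
    have "((\<lambda>r. ?c i * pperm_summand r + vector_field (subdivide i) (pperm_summand r)) has_sum
        (?c i * F + vector_field (subdivide i) F)) UNIV"
      by (intro has_sum_add has_sum_mps_mult_left F mps_derivation.has_sum[OF mps_derivation_vector_field])
    then have "((?h \<circ> ?s) has_sum (?c i * F + vector_field (subdivide i) F)) UNIV"
      by (simp only: pperm_summand_Suc[symmetric] o_def) (simp add: axis_def)
    then have "(?h has_sum (?c i * F + vector_field (subdivide i) F)) (range ?s)"
      by (subst has_sum_reindex) auto
    moreover have "?h r = 0" if "r \<notin> range ?s" for r
    proof -
      have "r = ?s (\<chi> j. if j = i then r $ i - 1 else r $ j)" if "r $ i \<noteq> 0"
        using that by (auto simp: vec_eq_iff axis_def)
      then have "r $ i = 0" using that by blast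
      then show ?thesis by simp
    qed
    ultimately show ?thesis
      by (subst has_sum_cong_neutral[where T = "range ?s" and g = ?h]) auto
  qed
  have "((\<lambda>r. \<Sum>i\<in>UNIV. of_nat (r $ i) * pperm_summand r) has_sum
      (\<Sum>i\<in>UNIV. ?c i * F + vector_field (subdivide i) F)) UNIV"
    by (intro has_sum_sum_mps step)
  then have "((\<lambda>r. euler num_points (pperm_summand r)) has_sum
      (single_point_weight * F + vector_field subdivide_any F)) UNIV"
    by (simp only: euler_pperm_summand single_point_weight_def vector_field_sum
        sum.distrib[symmetric] sum_distrib_right of_nat_sum)
  with mps_derivation.has_sum[OF mps_derivation_euler F, of num_points]
  show ?thesis
    by (rule has_sum_unique)
qed

text \<open>
  All terms but the one for \<open>r = 0\<close> are homogeneous of positive weight.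
\<close>

lemma pperm_series_constant:
  assumes F: "(pperm_summand has_sum F) UNIV" and m: "weight num_points m = 0"
  shows "mps_coeff F m = mps_coeff 1 m"
proof -
  obtain K where K: "finite K" "{0} \<subseteq> K" "mps_coeff F m = (\<Sum>r\<in>K. mps_coeff (pperm_summand r) m)"
    by (rule has_sum_mps_coeffE[OF F, of "{0}" m]) auto
  have "mps_coeff (pperm_summand r) m = 0" if "r \<noteq> 0" for r
  proof (rule euler_eigen_coeff[OF euler_pperm_summand])
    obtain i where "r $ i \<noteq> 0" using \<open>r \<noteq> 0\<close> by (auto simp: vec_eq_iff)
    then show "weight num_points m \<noteq> (\<Sum>i\<in>UNIV. r $ i)"
      using m by auto
  qed
  then have F0: "mps_coeff F m = mps_coeff (pperm_summand 0) m"
    using K by (subst K(3), subst sum.mono_neutral_right[of K "{0}"]) auto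
  have "copies (0 :: nat ^ 'a) = {}"
    by (auto simp: copies_def)
  moreover have "partial_perms ({} :: ('a \<times> nat) set) = {Map.empty}"
    by (auto simp: partial_perms_def)
  moreover have "num_cycles (Map.empty :: 'a \<times> nat \<rightharpoonup> 'a \<times> nat) = 0"
    using num_cycles_eq_card_cycles_of[of "{}" "Map.empty :: 'a \<times> nat \<rightharpoonup> 'a \<times> nat"]
    by (simp add: partial_perms_def cycles_of_def)
  ultimately have "pperm_indet (0 :: nat ^ 'a) = 1"
    by (simp add: pperm_copies_def pperm_def)
  then have "pperm_summand (0 :: nat ^ 'a) = 1"
    by (simp add: pperm_summand_def mps_const_1)
  with F0 show ?thesis by simp
qed

lemma mps_indet_coeff_0 [simp]: "mps_coeff (mps_indet v) 0 = 0"
  using add_single_neq_0[of 0 v] by (simp add: mps_indet_def)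

lemma mps_coeff_indet_mult_0: "mps_coeff (mps_indet v * g) 0 = 0"
proof -
  have "ord_ge 1 (mps_indet v)"
    unfolding ord_ge_1_iff by simp
  then have "ord_ge (1 + 0) (mps_indet v * g)"
    by (rule ord_ge_mult) simp
  then show ?thesis
    unfolding add_0_right ord_ge_1_iff .
qed

section \<open>The exponent\<close>

lemma euler_indet_matrix: "euler num_points (indet_A $ i $ j) = mat_pow indet_A (Suc 0) $ i $ j"
  by (simp add: mat_pow_1 euler_indet)

lemma subdivide_indet_matrix: "vector_field subdivide_any (indet_A $ i $ j) = mat_pow indet_A (Suc 1) $ i $ j"
  by (simp add: mat_pow_1 mat_pow_Suc[of _ "Suc 0"] matrix_mult_nth)

text \<open>
  The two halves of the exponent, in the grading by the number of points: chains with \<open>k + 1\<close> points,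
  and cycles with \<open>k + 1\<close> points. In a cycle the factor \<open>1 / (k + 1)\<close> accounts for the choice of the
  initial point.
\<close>

definition chain :: "nat \<Rightarrow> ('n::finite indet, rat) mps" where
  "chain k = bilin indet_\<theta> (mat_pow indet_A k) indet_\<phi>"

definition cycle :: "nat \<Rightarrow> ('n::finite indet, rat) mps" where
  "cycle k = mps_indet Beta * (mps_const (1 / of_nat (Suc k)) * trace (mat_pow indet_A (Suc k)))"

lemma chain_euler:
  "euler num_points (chain k :: ('n::finite indet, rat) mps) = of_nat (Suc k) * chain k"
proof -
  interpret mps_derivation "euler num_points :: ('n indet, rat) mps \<Rightarrow> _"
    by (rule mps_derivation_euler)
  have th: "euler num_points (indet_\<theta> $ j :: ('n indet, rat) mps) =
      (\<Sum>i\<in>UNIV. indet_\<theta> $ i * mat_pow indet_A 0 $ i $ j)" for j :: 'n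
    by (simp add: euler_indet mat_pow_0 mat_def if_distrib cong: if_cong)
  have ph: "euler num_points (indet_\<phi> $ i) =
      of_nat 0 * (\<Sum>j\<in>UNIV. mat_pow indet_A 0 $ i $ j * indet_\<phi> $ j)" for i :: 'n
    by (simp add: euler_indet)
  show ?thesis
    using bilin_mat_pow[OF euler_indet_matrix th ph, of k] by (simp add: chain_def)
qed

lemma chain_field:
  "vector_field subdivide_any (chain k :: ('n::finite indet, rat) mps) = of_nat (Suc (Suc k)) * chain (Suc k)"
proof -
  interpret mps_derivation "vector_field subdivide_any :: ('n indet, rat) mps \<Rightarrow> _"
    by (rule mps_derivation_vector_field)
  have th: "vector_field subdivide_any (indet_\<theta> $ j :: ('n indet, rat) mps) =
      (\<Sum>i\<in>UNIV. indet_\<theta> $ i * mat_pow indet_A 1 $ i $ j)" for j :: 'n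
    by (simp add: mat_pow_1)
  have ph: "vector_field subdivide_any (indet_\<phi> $ i) =
      of_nat 1 * (\<Sum>j\<in>UNIV. mat_pow indet_A 1 $ i $ j * indet_\<phi> $ j)" for i :: 'n
    by (simp add: mat_pow_1)
  show ?thesis
    using bilin_mat_pow[OF subdivide_indet_matrix th ph, of k] by (simp add: chain_def)
qed

lemma mps_const_inverse_of_nat:
  "mps_const (1 / of_nat (Suc k)) * (of_nat (Suc k) * f) = (f :: ('v, 'a::field_char_0) mps)"
  unfolding mps_const_of_nat[symmetric] mult.assoc[symmetric] mps_const_mult
  by (simp add: mps_const_1 del: of_nat_Suc)

lemma cycle_euler:
  "euler num_points (cycle k :: ('n::finite indet, rat) mps) = of_nat (Suc k) * cycle k"
proof -
  interpret mps_derivation "euler num_points :: ('n indet, rat) mps \<Rightarrow> _"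
    by (rule mps_derivation_euler)
  show ?thesis
    unfolding cycle_def
    by (simp add: mult const euler_indet trace_mat_pow[OF euler_indet_matrix] mult_ac del: of_nat_Suc)
qed

lemma cycle_field:
  "vector_field subdivide_any (cycle k :: ('n::finite indet, rat) mps) = of_nat (Suc (Suc k)) * cycle (Suc k)"
proof -
  interpret mps_derivation "vector_field subdivide_any :: ('n indet, rat) mps \<Rightarrow> _"
    by (rule mps_derivation_vector_field)
  have "vector_field subdivide_any (cycle k :: ('n indet, rat) mps) =
      mps_indet Beta * trace (mat_pow indet_A (Suc (Suc k)))"
    unfolding cycle_def
    by (simp add: mult const trace_mat_pow[OF subdivide_indet_matrix] mps_const_inverse_of_nat del: of_nat_Suc)
  also have "\<dots> = of_nat (Suc (Suc k)) * cycle (Suc k)"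
    using mps_const_inverse_of_nat[of "Suc k" "trace (mat_pow indet_A (Suc (Suc k))) :: ('n indet, rat) mps"]
    by (simp add: cycle_def mult_ac del: of_nat_Suc)
  finally show ?thesis .
qed

lemma chain_has_sum:
  "((chain :: nat \<Rightarrow> ('n::finite indet, rat) mps) has_sum
    (\<Sum>i\<in>UNIV. (indet_\<theta> v* inv_I_minus indet_A) $ i * indet_\<phi> $ i)) UNIV"
proof -
  have "((\<lambda>k. mat_pow indet_A k $ i $ j) has_sum inv_I_minus indet_A $ i $ j) UNIV" for i j :: 'n
    using has_sum_infsum[OF inv_I_minus_summable[of indet_A i j]] by (simp add: inv_I_minus_def)
  then have "((\<lambda>k.
      \<Sum>i\<in>(UNIV :: 'n set). \<Sum>j\<in>UNIV. (indet_\<theta> $ j * indet_\<phi> $ i) * mat_pow indet_A k $ j $ i) has_sum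
      (\<Sum>i\<in>(UNIV :: 'n set). \<Sum>j\<in>UNIV. (indet_\<theta> $ j * indet_\<phi> $ i) * inv_I_minus indet_A $ j $ i)) UNIV"
    by (intro has_sum_sum_mps has_sum_mps_mult_left)
  moreover have "(\<Sum>i\<in>(UNIV :: 'n set). \<Sum>j\<in>UNIV. (indet_\<theta> $ j * indet_\<phi> $ i) * mat_pow indet_A k $ j $ i)
      = chain k" for k
    unfolding chain_def bilin_def by (subst sum.swap) (simp add: mult_ac)
  moreover have "(\<Sum>i\<in>(UNIV :: 'n set). \<Sum>j\<in>UNIV. (indet_\<theta> $ j * indet_\<phi> $ i) * inv_I_minus indet_A $ j $ i) =
      (\<Sum>i\<in>UNIV. (indet_\<theta> v* inv_I_minus indet_A) $ i * indet_\<phi> $ i)"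
    by (simp add: vector_matrix_mult_def sum_distrib_left mult_ac)
  ultimately show ?thesis by (simp only:)
qed

lemma cycle_has_sum:
  "((cycle :: nat \<Rightarrow> ('n::finite indet, rat) mps) has_sum
    (mps_indet Beta * (\<Sum>\<^sub>\<infinity>t\<in>{1..}. mps_const (1 / of_nat t) * trace (mat_pow indet_A t)))) UNIV"
proof -
  let ?f = "\<lambda>t. mps_const (1 / of_nat t) * trace (mat_pow indet_A t) :: ('n indet, rat) mps"
  have "(?f has_sum (\<Sum>\<^sub>\<infinity>t\<in>{1..}. ?f t)) {1..}"
    by (intro has_sum_infsum log_det_summable) simp
  also have "{1..} = range Suc"
    by (auto simp: image_iff Suc_le_eq gr0_conv_Suc)
  finally have "((?f \<circ> Suc) has_sum (\<Sum>\<^sub>\<infinity>t\<in>range Suc. ?f t)) UNIV"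
    by (subst (asm) has_sum_reindex) auto
  from has_sum_mps_mult_left[OF this, of "mps_indet Beta"]
  show ?thesis
    unfolding \<open>{1..} = range Suc\<close> o_def cycle_def .
qed

lemma ord_ge_subdivide: "ord_ge 2 (subdivide i v)" for i :: "'n::finite"
proof -
  have one: "ord_ge 1 (mps_indet u :: ('n indet, rat) mps)" for u
    unfolding ord_ge_1_iff by simp
  have "ord_ge (1 + 1) (mps_indet u * mps_indet v :: ('n indet, rat) mps)" for u v
    by (intro ord_ge_mult one)
  then show ?thesis
    by (cases v) (simp_all add: numeral_2_eq_2)
qed

theorem theorem4p1:
  fixes \<beta> :: "('n::finite indet, rat) mps"
    and A :: "('n indet, rat) mps ^ 'n ^ 'n"
    and \<theta> \<phi> :: "('n indet, rat) mps ^ 'n"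
  assumes "\<beta> = mps_indet Beta"
    and "A = (\<chi> i j. mps_indet (Entry i j))"
    and "\<theta> = (\<chi> i. mps_indet (Theta i))"
    and "\<phi> = (\<chi> i. mps_indet (Phi i))"
  shows "((\<lambda>r :: nat ^ 'n. mps_const (1 / (\<Prod>i\<in>UNIV. fact (r $ i))) * pperm_copies \<beta> \<theta> \<phi> A r)
      has_sum
        (mps_exp (\<Sum>i\<in>UNIV. (\<theta> v* inv_I_minus A) $ i * \<phi> $ i) * det_I_minus_powr_minus \<beta> A)) UNIV"
proof -
  let ?D = "vector_field subdivide_any :: ('n indet, rat) mps \<Rightarrow> _"
  let ?E = "euler num_points :: ('n indet, rat) mps \<Rightarrow> _"
  interpret E: mps_derivation ?E by (rule mps_derivation_euler)
  interpret D: mps_derivation ?D by (rule mps_derivation_vector_field)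
  define G where "G = (\<Sum>i\<in>UNIV. (\<theta> v* inv_I_minus A) $ i * \<phi> $ i)"
  define H where "H = \<beta> * (\<Sum>\<^sub>\<infinity>t\<in>{1..}. mps_const (1 / of_nat t) * trace (mat_pow A t))"
  define R where "R = mps_exp G * mps_exp H"
  have G: "(chain has_sum G) UNIV" and H: "(cycle has_sum H) UNIV"
    unfolding G_def H_def assms by (rule chain_has_sum cycle_has_sum)+
  note EG = graded_series[OF G chain_euler chain_field] and EH = graded_series[OF H cycle_euler cycle_field]
  have G0: "mps_coeff G 0 = 0" and H0: "mps_coeff H 0 = 0"
    by (simp_all add: EG EH)
  \<comment> \<open>chains and cycles with a single point\<close>
  have "chain 0 + cycle 0 = (single_point_weight :: ('n indet, rat) mps)"
    by (simp add: chain_def cycle_def bilin_def single_point_weight_def mat_pow_0 mat_pow_1 trace_def mat_def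
        mps_const_1 sum.distrib sum_distrib_left if_distrib if_distribR cong: if_cong)
  then have R: "?E R = single_point_weight * R + ?D R"
    unfolding R_def E.mult D.mult E.exp[OF G0] E.exp[OF H0] D.exp[OF G0] D.exp[OF H0] EG(1) EH(1)
    by (simp add: algebra_simps flip: \<open>chain 0 + cycle 0 = single_point_weight\<close>)
  have R0: "mps_coeff R m = mps_coeff 1 m" if m: "weight num_points m = 0" for m
  proof -
    have "mps_coeff (mps_exp G - 1) m = 0" if "weight num_points m = 0" for m
      using weight_zero_exp[of num_points G, OF EG(2) that] by simp
    from weight_zero_mult[OF this m, of "mps_exp H"] weight_zero_exp[of num_points H, OF EH(2) m]
    show ?thesis
      by (simp add: R_def left_diff_distrib)
  qed
  obtain F where F: "(pperm_summand has_sum (F :: ('n indet, rat) mps)) UNIV"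
    using pperm_summand_has_sum by blast
  have "F = R"
  proof (rule euler_unique)
    show "?E F = single_point_weight * F + ?D F"
      by (rule pperm_series_equation[OF F])
    show "?E R = single_point_weight * R + ?D R"
      by (rule R)
    show "mps_coeff F m = mps_coeff R m" if "weight num_points m = 0" for m
      using pperm_series_constant[OF F that] R0[OF that] by simp
    show "ord_ge 2 (subdivide_any v)" for v :: "'n indet"
      by (intro ord_ge_sum ord_ge_subdivide)
    show "ord_ge 1 (single_point_weight :: ('n indet, rat) mps)"
      unfolding ord_ge_1_iff single_point_weight_def by (simp add: mps_coeff_indet_mult_0)
  qed
  with F have "(pperm_summand has_sum (mps_exp G * mps_exp H)) UNIV"
    by (simp only: R_def)
  then show ?thesis
    unfolding pperm_summand_def[abs_def] G_def H_def det_I_minus_powr_minus_def assms .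
qed

end
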